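(* Let $\alpha$ be a positive real number. For any partition $\lambda$ and any integer $r\ge0$ we have $$\sigma_r(\lambda)=c_{r+1}-\alpha\,c_{r+2},$$ where for every integer $r\ge 0$ $$c_r=\sum_{\substack{n,p,q\ge0\\ 2n+p+q\le r}}\left(-\frac1\alpha\right)^n\left(1+\frac1\alpha\right)^p\binom{n+p+q-1}{p}\left(\sum_{k=0}^{\min(n,r-2n-p)}\binom{|\lambda|+n-1}{n-k}F_{r-2n-p,q,k}(\lambda)\right).$$
   Context: A partition $\mu=(\mu_1,\ldots,\mu_l)$ is a finite weakly decreasing sequence of positive integers; $l(\mu)=l$ is its length, $|\mu|=\sum_i\mu_i$ its weight, $m_i(\mu)$ the number of parts equal to $i$, and $z_\mu=\prod_{i\ge1} i^{m_i(\mu)}m_i(\mu)!$. A partition is identified with its diagram $\{(i,j):1\le i\le l(\mu),\,1\le j\le\mu_i\}$. Write $\binom{a}{n}=a(a-1)\cdots(a-n+1)/n!$ for $n\ge 0$ (so $\binom a0=1$ for every $a$); $\binom{a}{n}=0$ for $n<0$. The quantity $\sigma_r(\lambda)$ is $$\sigma_r(\lambda)=\sum_{i=1}^{l(\lambda)}\left(\lambda_i-\frac{i-1}{\alpha}\right)^r\binom{\lambda}{\lambda_{(i)}}_{\alpha},\qquad \binom{\lambda}{\lambda_{(i)}}_{\alpha}=\left(\lambda_i+\frac{l(\lambda)-i}{\alpha}\right)\prod_{\substack{j=1\\ j\ne i}}^{l(\lambda)}\frac{\alpha(\lambda_i-\lambda_j)+j-i-1}{\alpha(\lambda_i-\lambda_j)+j-i}.$$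 (Here $\lambda_{(i)}$ is obtained from $\lambda$ by decreasing $\lambda_i$ by one; $\binom{\lambda}{\lambda_{(i)}}_\alpha$ is the generalized binomial coefficient of the binomial formula for Jack polynomials, and the product above is $0$ when $\lambda_{(i)}$ is not a partition.) For a cell $(i,j)\in\lambda$ let $c_{ij}^{\alpha}=j-1-(i-1)/\alpha$. For $k\ge1$ put $d_k(\lambda)=\sum_{(i,j)\in\lambda}(c_{ij}^\alpha)^k$, and for a partition $\mu$ put $d_\mu(\lambda)=\prod_{i\ge1}d_i(\lambda)^{m_i(\mu)}$. For integers $n,p,k$ with $n\ge 1$, $k\ge1$, $0\le p\le n$ define $$\binom{n}{p}_{k}=\frac{n}{k}\sum_{r\ge0}\binom{p}{r}\binom{n-p}{r}\binom{n-r-1}{k-r-1}.$$ For a nonempty partition $\mu$ and integers $0\le p\le|\mu|$, $k\ge1$ define $$\genfrac{\langle}{\rangle}{0pt}{}{\mu}{p}_{k}=\sum_{(p_i)}\sum_{(k_i)}\prod_{i=1}^{l(\mu)}\binom{\mu_i}{p_i}_{k_i},$$ the sum being over all decompositions $p=\sum_{i}p_i$, $k=\sum_{i}k_i$ with $0\le p_i\le\mu_i$ and $k_i\ge 1$ for all $i$. For $n\ge1$, $k\ge1$, $0\le p\le n$ define $$F_{npk}(\lambda)=\sum_{|\mu|=n}\frac{1}{z_\mu}\genfrac{\langle}{\rangle}{0pt}{}{\mu}{p}_{k}\,d_\mu(\lambda)$$ (sum over partitions $\mu$ of $n$); for $k=0$, $F_{np0}(\lambda)=0$ with the only exception $F_{000}(\lambda)=1$.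 *)

theory Defs
  imports Complex_Main
begin

section \<open>Partitions\<close>

text \<open>Partitions are lists of their parts, without trailing zeros.\<close>

definition is_partition :: "nat list \<Rightarrow> bool" where
  "is_partition mu \<longleftrightarrow> sorted_wrt (\<ge>) mu \<and> (\<forall>x\<in>set mu. 0 < x)"

abbreviation weight :: "nat list \<Rightarrow> nat" where
  "weight mu \<equiv> sum_list mu"

text \<open>Parts are numbered from 1; only used for \<open>1 \<le> i \<le> length mu\<close>.\<close>

definition part :: "nat list \<Rightarrow> nat \<Rightarrow> nat" where
  "part mu i = mu ! (i - 1)"

definition partitions_of :: "nat \<Rightarrow> nat list set" where
  "partitions_of n = {mu. is_partition mu \<and> weight mu = n}"

abbreviation mult :: "nat list \<Rightarrow> nat \<Rightarrow> nat" where
  "mult mu i \<equiv> count_list mu i"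

text \<open>In the products over all \<open>i \<ge> 1\<close> below, the factor of an \<open>i\<close> that is not a part of
  \<open>mu\<close> is 1, so they run over the parts that occur.\<close>

definition zpart :: "nat list \<Rightarrow> nat" where
  "zpart mu = (\<Prod>i\<in>set mu. i ^ mult mu i * fact (mult mu i))"

definition diagram :: "nat list \<Rightarrow> (nat \<times> nat) set" where
  "diagram mu = {(i, j). 1 \<le> i \<and> i \<le> length mu \<and> 1 \<le> j \<and> j \<le> part mu i}"

section \<open>Binomial coefficients\<close>

definition binom :: "real \<Rightarrow> int \<Rightarrow> real" where
  "binom a n = (if n < 0 then 0 else a gchoose (nat n))"

text \<open>The sum over all \<open>r \<ge> 0\<close> stops at \<open>p\<close>, since \<open>binom p r = 0\<close> for \<open>r > p\<close>.\<close>

definition nbinom :: "nat \<Rightarrow> nat \<Rightarrow> nat \<Rightarrow> real" where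
  "nbinom n p k = real n / real k *
     (\<Sum>r\<le>p. binom (real p) (int r) * binom (real n - real p) (int r)
             * binom (real n - real r - 1) (int k - int r - 1))"

text \<open>Decompositions \<open>p = \<Sum> p\<^sub>i\<close> with \<open>0 \<le> p\<^sub>i \<le> mu\<^sub>i\<close>, and
  \<open>k = \<Sum> k\<^sub>i\<close> into \<open>l\<close> summands \<open>k\<^sub>i \<ge> 1\<close>.\<close>

definition decomp_below :: "nat list \<Rightarrow> nat \<Rightarrow> nat list set" where
  "decomp_below mu p =
     {ps. length ps = length mu \<and> sum_list ps = p \<and>
          (\<forall>i. 1 \<le> i \<and> i \<le> length mu \<longrightarrow> part ps i \<le> part mu i)}"

definition decomp_pos :: "nat \<Rightarrow> nat \<Rightarrow> nat list set" where
  "decomp_pos l k = {ks. length ks = l \<and> sum_list ks = k \<and> (\<forall>x\<in>set ks. 1 \<le> x)}"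

definition abinom :: "nat list \<Rightarrow> nat \<Rightarrow> nat \<Rightarrow> real" where
  "abinom mu p k =
     (\<Sum>ps\<in>decomp_below mu p. \<Sum>ks\<in>decomp_pos (length mu) k.
        \<Prod>i=1..length mu. nbinom (part mu i) (part ps i) (part ks i))"

section \<open>Functions of a partition with Jack parameter\<close>

text \<open>This is the generalized binomial coefficient \<open>\<lambda>\<close> over \<open>\<lambda>\<^sub>(\<^sub>i\<^sub>)\<close> of the binomial
  formula for Jack polynomials, where \<open>\<lambda>\<^sub>(\<^sub>i\<^sub>)\<close> is \<open>\<lambda>\<close> with its \<open>i\<close>-th part decreased by one.
  It vanishes when \<open>\<lambda>\<^sub>(\<^sub>i\<^sub>)\<close> is not a partition. For \<open>\<alpha> > 0\<close> no denominator is zero.\<close>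

definition jack_binom :: "real \<Rightarrow> nat list \<Rightarrow> nat \<Rightarrow> real" where
  "jack_binom \<alpha> lam i =
     (real (part lam i) + (real (length lam) - real i) / \<alpha>) *
     (\<Prod>j\<in>{1..length lam} - {i}.
        (\<alpha> * (real (part lam i) - real (part lam j)) + real j - real i - 1) /
        (\<alpha> * (real (part lam i) - real (part lam j)) + real j - real i))"

definition sigma :: "real \<Rightarrow> nat \<Rightarrow> nat list \<Rightarrow> real" where
  "sigma \<alpha> r lam =
     (\<Sum>i=1..length lam.
        (real (part lam i) - (real i - 1) / \<alpha>) ^ r * jack_binom \<alpha> lam i)"

definition content :: "real \<Rightarrow> nat \<Rightarrow> nat \<Rightarrow> real" where
  "content \<alpha> i j = real j - 1 - (real i - 1) / \<alpha>"

definition dpow :: "real \<Rightarrow> nat \<Rightarrow> nat list \<Rightarrow> real" where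
  "dpow \<alpha> k lam = (\<Sum>(i, j)\<in>diagram lam. content \<alpha> i j ^ k)"

definition dpart :: "real \<Rightarrow> nat list \<Rightarrow> nat list \<Rightarrow> real" where
  "dpart \<alpha> mu lam = (\<Prod>i\<in>set mu. dpow \<alpha> i lam ^ mult mu i)"

definition Ffun :: "real \<Rightarrow> nat \<Rightarrow> nat \<Rightarrow> nat \<Rightarrow> nat list \<Rightarrow> real" where
  "Ffun \<alpha> n p k lam =
     (if k = 0 then (if n = 0 \<and> p = 0 then 1 else 0)
      else (\<Sum>mu\<in>partitions_of n. 1 / real (zpart mu) * abinom mu p k * dpart \<alpha> mu lam))"

text \<open>The upper entries \<open>n + p + q - 1\<close> and \<open>|\<lambda>| + n - 1\<close> can be \<open>-1\<close>, and the lower entry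
  is then 0, so that the binomial coefficient is 1.\<close>

definition cfun :: "real \<Rightarrow> nat \<Rightarrow> nat list \<Rightarrow> real" where
  "cfun \<alpha> r lam =
     (\<Sum>(n, p, q)\<in>{(n, p, q). 2 * n + p + q \<le> r}.
        (- 1 / \<alpha>) ^ n * (1 + 1 / \<alpha>) ^ p * binom (real n + real p + real q - 1) (int p) *
        (\<Sum>k=0..min n (r - 2 * n - p).
           binom (real (weight lam) + real n - 1) (int n - int k) *
           Ffun \<alpha> (r - 2 * n - p) q k lam))"

section \<open>Finiteness of the summation ranges\<close>

lemma finite_lists_weight_le: "finite {xs :: nat list. length xs \<le> l \<and> sum_list xs \<le> n}"
proof (rule finite_subset)
  show "{xs :: nat list. length xs \<le> l \<and> sum_list xs \<le> n}
        \<subseteq> {xs. set xs \<subseteq> {..n} \<and> length xs \<le> l}"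
    by (auto dest: member_le_sum_list)
qed (simp add: finite_lists_length_le)

lemma length_le_weight: "(\<forall>x\<in>set xs. 0 < x) \<Longrightarrow> length xs \<le> weight xs"
  by (induction xs) auto

lemma finite_partitions_of: "finite (partitions_of n)"
  by (rule finite_subset[OF _ finite_lists_weight_le[of n n]])
    (auto simp: partitions_of_def is_partition_def dest: length_le_weight)

lemma finite_decomp_below: "finite (decomp_below mu p)"
  by (rule finite_subset[OF _ finite_lists_weight_le[of "length mu" p]])
    (auto simp: decomp_below_def)

lemma finite_decomp_pos: "finite (decomp_pos l k)"
  by (rule finite_subset[OF _ finite_lists_weight_le[of l k]])
    (auto simp: decomp_pos_def)

lemma finite_diagram: "finite (diagram mu)"
proof -
  have "diagram mu = (SIGMA i:{1..length mu}. {1..part mu i})"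
    by (auto simp: diagram_def)
  then show ?thesis by simp
qed

lemma finite_cfun_range: "finite {(n, p, q). 2 * n + p + q \<le> (r :: nat)}"
  by (rule finite_subset[of _ "{..r} \<times> {..r} \<times> {..r}"]) auto

end

theory Submission
  imports Defs "HOL-Computational_Algebra.Formal_Power_Series" "HOL-Library.Multiset"
begin

hide_const (open) Multiset.mult
unbundle fps_syntax

text \<open>
Put \<open>b = 1 / \<alpha>\<close> and consider the formal power series
  \<open>G(T) = \<Prod>\<^sub>c (1 - c T) (1 - (c + 1 + b) T) / ((1 - (c + 1) T) (1 - (c + b) T))\<close>,
where \<open>c\<close> runs over the contents of the cells of \<open>\<lambda>\<close>. The theorem holds because \<open>G\<close> can be
expanded in two ways.

On the one hand, the product telescopes along every row, and what remains at the left ends of the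
rows telescopes once more. With \<open>a\<^sub>i = \<lambda>\<^sub>i - (i - 1) b\<close> and \<open>s = - (l - 1) b\<close> this leaves
  \<open>(1 - b T) G(T) = (1 - s T) \<Prod>\<^sub>i (1 - (a\<^sub>i + b) T) / (1 - a\<^sub>i T)\<close>   (\<open>diagram_product\<close>).
The \<open>a\<^sub>i\<close> are distinct, and the partial fraction decomposition of the right-hand side
(\<open>resolvent_product\<close>) has the Jack binomial coefficients as residues: up to terms of degree at
most 1 it is \<open>- b T\<^sup>2 \<Sum>\<^sub>r \<sigma>\<^sub>r T\<^sup>r\<close>. Comparing coefficients gives
\<open>\<sigma>\<^sub>r = G\<^sub>r\<^sub>+\<^sub>1 - \<alpha> G\<^sub>r\<^sub>+\<^sub>2\<close>.

On the other hand, \<open>G\<^sub>r = c\<^sub>r\<close> (\<open>cfun_eq_coeff\<close>). The source of this is the generating function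
  \<open>\<Sum>\<^sub>n\<^sub>,\<^sub>q\<^sub>,\<^sub>k F\<^sub>n\<^sub>q\<^sub>k S\<^sup>n y\<^sup>q x\<^sup>k = \<Prod>\<^sub>c 1 / (1 - x (1 / ((1 - c S) (1 - c S y)) - 1))\<close>
(\<open>prod_cell_series_nth\<close>). It is an instance of the classical identity
\<open>\<Sum>\<^sub>\<mu> p\<^sub>\<mu> S\<^sup>|\<^sup>\<mu>\<^sup>| / z\<^sub>\<mu> = exp (\<Sum>\<^sub>n p\<^sub>n S\<^sup>n / n)\<close>, used here in the form of the recurrence
\<open>n h\<^sub>n = \<Sum>\<^sub>i p\<^sub>i h\<^sub>n\<^sub>-\<^sub>i\<close>, that is, of a logarithmic derivative. The power sums are
\<open>d\<^sub>n(\<lambda>) \<Sum>\<^sub>p\<^sub>,\<^sub>k (n over p)\<^sub>k y\<^sup>p x\<^sup>k\<close>, and their second factor comes from the logarithmic derivative of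
a single factor of the product, since the numbers \<open>(n over p)\<^sub>k\<close> are, up to the factor \<open>n / k\<close>, the
coefficients of the powers of \<open>1 / ((1 - A) (1 - B)) - 1\<close> (\<open>bi_fps_ucount_eq_power\<close>,
\<open>nbinom_eq_ucount\<close>).

Now let \<open>v = 1 / (1 - (1 + b) T)\<close> and \<open>e = - b T\<^sup>2 v\<close>, and substitute \<open>S = T\<close>, \<open>y = v\<close>,
\<open>x = e / (1 - e)\<close>. After multiplication by \<open>1 / (1 - e)\<close> each factor of the product is exactly the
corresponding factor of \<open>G\<close> (\<open>gen_cell\<close>). Expanding
\<open>(1 - e)\<^sup>-\<^sup>|\<^sup>\<lambda>\<^sup>| v\<^sup>q x\<^sup>k = e\<^sup>k (1 - e)\<^sup>-\<^sup>(\<^sup>|\<^sup>\<lambda>\<^sup>|\<^sup>+\<^sup>k\<^sup>) v\<^sup>q\<close> by the negative binomial series yields the two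
families of binomial coefficients in the definition of \<open>c\<^sub>r\<close> (\<open>weighted_power_nth\<close>).

Since \<open>x\<close> and \<open>y\<close> become power series in \<open>T\<close>, the generating function lives in power series in \<open>S\<close>
over \<open>\<real>[[T]]\<close>, and setting \<open>S = T\<close> is the ring homomorphism \<open>merge_vars\<close>.
\<close>

section \<open>Powers of the two-variable geometric series\<close>

text \<open>The two-variable series \<open>\<Sum> h m p A\<^sup>m B\<^sup>p\<close> at \<open>A = a S\<close> and \<open>B = b S\<close>. Keeping it as a series
in the single variable \<open>S\<close> makes it possible to differentiate with respect to \<open>S\<close>.\<close>

definition bi_fps :: "'a::comm_ring_1 \<Rightarrow> 'a \<Rightarrow> (nat \<Rightarrow> nat \<Rightarrow> nat) \<Rightarrow> 'a fps" where
  "bi_fps a b h = Abs_fps (\<lambda>n. \<Sum>p\<le>n. of_nat (h (n - p) p) * a ^ (n - p) * b ^ p)"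

lemma bi_fps_nth: "bi_fps a b h $ n = (\<Sum>p\<le>n. of_nat (h (n - p) p) * a ^ (n - p) * b ^ p)"
  by (simp add: bi_fps_def)

lemma bi_fps_add: "bi_fps a b (\<lambda>m p. g m p + h m p) = bi_fps a b g + bi_fps a b h"
  by (rule fps_ext) (simp add: bi_fps_nth algebra_simps sum.distrib)

lemma bi_fps_shift_left:
  "fps_const a * fps_X * bi_fps a b h = bi_fps a b (\<lambda>m p. case m of 0 \<Rightarrow> 0 | Suc m \<Rightarrow> h m p)"
proof (rule fps_ext)
  fix n
  show "(fps_const a * fps_X * bi_fps a b h) $ n
      = bi_fps a b (\<lambda>m p. case m of 0 \<Rightarrow> 0 | Suc m \<Rightarrow> h m p) $ n"
  proof (cases n)
    case (Suc n')
    have "(\<Sum>p\<le>n'. a * (of_nat (h (n' - p) p) * a ^ (n' - p) * b ^ p)) =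
      (\<Sum>p\<le>n'. of_nat (case Suc n' - p of 0 \<Rightarrow> 0 | Suc m \<Rightarrow> h m p) * a ^ (Suc n' - p) * b ^ p)"
      by (rule sum.cong) (auto simp: Suc_diff_le mult_ac)
    then show ?thesis
      using Suc by (simp add: bi_fps_nth mult.assoc sum_distrib_left)
  qed (simp add: bi_fps_nth mult.assoc)
qed

lemma bi_fps_swap: "bi_fps a b h = bi_fps b a (\<lambda>m p. h p m)"
proof (rule fps_ext)
  fix n
  show "bi_fps a b h $ n = bi_fps b a (\<lambda>m p. h p m) $ n"
    unfolding bi_fps_nth
    by (rule sum.reindex_bij_witness[of _ "\<lambda>p. n - p" "\<lambda>p. n - p"]) (auto simp: mult_ac)
qed

lemma bi_fps_shift_right:
  "fps_const b * fps_X * bi_fps a b h = bi_fps a b (\<lambda>m p. case p of 0 \<Rightarrow> 0 | Suc p \<Rightarrow> h m p)"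
  by (subst (1 2) bi_fps_swap) (rule bi_fps_shift_left)

text \<open>With \<open>U = 1 / ((1 - A) (1 - B)) - 1\<close>, these are the coefficients of \<open>U\<^sup>k (1 + U)\<close> and, below, of
\<open>U\<^sup>k\<^sup>+\<^sup>1\<close>. The second formula has no meaning at \<open>m = p = 0\<close>, where truncated subtraction would
produce the value 1 for \<open>k = 0\<close>; the constant coefficient of \<open>U\<^sup>k\<^sup>+\<^sup>1\<close> is 0.\<close>

definition wcount :: "nat \<Rightarrow> nat \<Rightarrow> nat \<Rightarrow> nat" where
  "wcount k m p = (\<Sum>r\<le>k. (p choose r) * (m choose r) * ((m + p - r) choose (k - r)))"

definition ucount :: "nat \<Rightarrow> nat \<Rightarrow> nat \<Rightarrow> nat" where
  "ucount k m p = (if m + p = 0 then 0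
     else (\<Sum>r\<le>k. (p choose r) * (m choose r) * ((m + p - 1 - r) choose (k - r))))"

text \<open>The coefficient form of \<open>U\<^sup>k\<^sup>+\<^sup>2 + U\<^sup>k\<^sup>+\<^sup>1 = U\<^sup>k\<^sup>+\<^sup>1 (1 + U)\<close>. It is Pascal's rule in each summand.\<close>

lemma ucount_add:
  assumes "m + p > 0"
  shows "ucount (Suc k) m p + ucount k m p = wcount (Suc k) m p"
proof -
  have *: "(p choose r) * (m choose r) * ((m + p - 1 - r) choose (Suc k - r)) +
       (p choose r) * (m choose r) * ((m + p - 1 - r) choose (k - r))
     = (p choose r) * (m choose r) * ((m + p - r) choose (Suc k - r))" if "r \<le> k" for r
  proof (cases "r \<le> p \<and> r \<le> m")
    case True
    then have "m + p - r = Suc (m + p - 1 - r)" "Suc k - r = Suc (k - r)"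
      using assms that by auto
    then show ?thesis by (simp add: algebra_simps)
  qed (auto simp: not_le binomial_eq_0)
  have "ucount (Suc k) m p + ucount k m p = (p choose Suc k) * (m choose Suc k) +
    (\<Sum>r\<le>k. (p choose r) * (m choose r) * ((m + p - 1 - r) choose (Suc k - r)) +
       (p choose r) * (m choose r) * ((m + p - 1 - r) choose (k - r)))"
    using assms by (auto simp: ucount_def sum.distrib)
  also have "\<dots> = (p choose Suc k) * (m choose Suc k) +
    (\<Sum>r\<le>k. (p choose r) * (m choose r) * ((m + p - r) choose (Suc k - r)))"
    using * by (intro arg_cong2[of _ _ _ _ "(+)"] refl sum.cong) auto
  also have "\<dots> = wcount (Suc k) m p"
    by (simp add: wcount_def)
  finally show ?thesis .
qed

text \<open>The coefficient form of \<open>U\<^sup>k\<^sup>+\<^sup>1 = (A + B - A B) U\<^sup>k (1 + U)\<close>, away from the axes. The left-hand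
side minus the two terms on the right combines, by Pascal's rule for the first two factors, to
\<open>(p over r - 1) (m over r - 1) - (p over r) (m over r)\<close>; after shifting \<open>r\<close> in the first part,
Pascal's rule for the third factor collapses everything.\<close>

lemma ucount_rec_Suc:
  "ucount k (Suc m) (Suc p) + wcount k m p = wcount k m (Suc p) + wcount k (Suc m) p"
proof -
  let ?C = "\<lambda>n j. int (n choose j)"
  define N where "N = m + p"
  have "int (ucount k (Suc m) (Suc p)) - int (wcount k m (Suc p)) - int (wcount k (Suc m) p)
    = (\<Sum>r\<le>k. (?C (Suc p) r * ?C (Suc m) r - ?C (Suc p) r * ?C m r - ?C p r * ?C (Suc m) r)
               * ?C (Suc N - r) (k - r))"
    by (simp add: ucount_def wcount_def N_def sum_subtractf left_diff_distrib)
  also have "\<dots> = (\<Sum>r\<le>k. (case r of 0 \<Rightarrow> 0 | Suc r \<Rightarrow> ?C p r * ?C m r * ?C (N - r) (k - Suc r)))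
     - (\<Sum>r\<le>k. ?C p r * ?C m r * ?C (Suc N - r) (k - r))"
    unfolding sum_subtractf[symmetric]
    by (rule sum.cong) (auto split: nat.splits simp: algebra_simps)
  also have "(\<Sum>r\<le>k. (case r of 0 \<Rightarrow> 0 | Suc r \<Rightarrow> ?C p r * ?C m r * ?C (N - r) (k - Suc r)))
     = (\<Sum>r<k. ?C p r * ?C m r * ?C (N - r) (k - Suc r))"
    by (cases k) (auto simp: sum.atMost_Suc_shift lessThan_Suc_atMost simp del: sum.atMost_Suc)
  also have "(\<Sum>r\<le>k. ?C p r * ?C m r * ?C (Suc N - r) (k - r))
     = (\<Sum>r<k. ?C p r * ?C m r * ?C (N - r) (k - Suc r))
       + (\<Sum>r\<le>k. ?C p r * ?C m r * ?C (N - r) (k - r))"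
  proof -
    have "?C p r * ?C m r * ?C (Suc N - r) (k - r) = ?C p r * ?C m r * ?C (N - r) (k - Suc r) +
       ?C p r * ?C m r * ?C (N - r) (k - r)" if "r < k" for r
    proof (cases "r \<le> p \<and> r \<le> m")
      case True
      then have "Suc N - r = Suc (N - r)" "k - r = Suc (k - Suc r)"
        using that by (auto simp: N_def)
      then show ?thesis by (simp add: algebra_simps)
    qed (auto simp: not_le binomial_eq_0)
    then have "(\<Sum>r<k. ?C p r * ?C m r * ?C (Suc N - r) (k - r))
     = (\<Sum>r<k. ?C p r * ?C m r * ?C (N - r) (k - Suc r))
       + (\<Sum>r<k. ?C p r * ?C m r * ?C (N - r) (k - r))"
      by (simp add: sum.distrib)
    moreover have "(\<Sum>r\<le>k. f r) = (\<Sum>r<k. f r) + f k" for f :: "nat \<Rightarrow> int"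
      by (simp flip: lessThan_Suc_atMost)
    ultimately show ?thesis
      by simp
  qed
  finally have "int (ucount k (Suc m) (Suc p)) - int (wcount k m (Suc p)) - int (wcount k (Suc m) p)
    = - int (wcount k m p)"
    by (simp add: wcount_def N_def)
  then show ?thesis by linarith
qed

lemma atMost_sum_at_0:
  assumes "\<And>r. r > 0 \<Longrightarrow> f r = (0::nat)" shows "(\<Sum>r\<le>(k::nat). f r) = f 0"
proof -
  have "(\<Sum>r\<le>k. f r) = (\<Sum>r\<in>{0}. f r)"
    by (rule sum.mono_neutral_right) (use assms in auto)
  then show ?thesis by simp
qed

lemma count_boundary:
  "wcount k m 0 = m choose k" "wcount k 0 m = m choose k"
  "ucount k (Suc m) 0 = m choose k" "ucount k 0 (Suc m) = m choose k" "ucount k 0 0 = 0"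
  by (simp_all add: wcount_def ucount_def atMost_sum_at_0)

context
  fixes a b :: "'a::comm_ring_1"
begin

abbreviation "lin_factor \<equiv> (1 - fps_const a * fps_X) * (1 - fps_const b * fps_X)"

text \<open>Here \<open>1 - lin_factor\<close> is \<open>A + B - A B\<close>.\<close>

lemma bi_fps_ucount:
  "bi_fps a b (ucount k) = (1 - lin_factor) * bi_fps a b (wcount k)"
proof -
  let ?l = "\<lambda>h m p. case m of 0 \<Rightarrow> 0 | Suc m \<Rightarrow> h m p"
  let ?r = "\<lambda>h m p. case p of 0 \<Rightarrow> 0 | Suc p \<Rightarrow> h m p"
  have "(\<lambda>m p. ucount k m p + ?l (?r (wcount k)) m p) = (\<lambda>m p. ?l (wcount k) m p + ?r (wcount k) m p)"
    by (intro ext) (auto split: nat.splits simp: ucount_rec_Suc count_boundary)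
  then have "bi_fps a b (ucount k) + bi_fps a b (?l (?r (wcount k)))
     = bi_fps a b (?l (wcount k)) + bi_fps a b (?r (wcount k))"
    by (simp only: bi_fps_add[symmetric])
  then show ?thesis
    unfolding bi_fps_shift_left[symmetric] bi_fps_shift_right[symmetric]
    by (simp add: algebra_simps del: fps_const_mult)
qed

lemma bi_fps_wcount_0: "lin_factor * bi_fps a b (wcount 0) = 1"
proof -
  have "(\<lambda>m p. ucount 0 m p + (if m + p = 0 then 1 else 0)) = wcount 0"
    by (intro ext) (auto simp: ucount_def wcount_def)
  then have "bi_fps a b (wcount 0) = bi_fps a b (ucount 0) + bi_fps a b (\<lambda>m p. if m + p = 0 then 1 else 0)"
    by (simp add: bi_fps_add[symmetric])
  also have "bi_fps a b (\<lambda>m p. if m + p = 0 then 1 else 0) = 1"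
    by (rule fps_ext) (auto simp: bi_fps_nth intro!: sum.neutral)
  finally show ?thesis unfolding bi_fps_ucount by (simp add: algebra_simps)
qed

text \<open>Unlike in \<open>ucount_add\<close>, the constant coefficient is included: all three of them vanish.\<close>

lemma bi_fps_wcount_Suc:
  "bi_fps a b (wcount (Suc k)) = bi_fps a b (ucount (Suc k)) + bi_fps a b (ucount k)"
proof -
  have "wcount (Suc k) m p = ucount (Suc k) m p + ucount k m p" for m p
  proof (cases "m + p = 0")
    case True then show ?thesis by (simp add: wcount_def ucount_def)
  qed (use ucount_add in simp)
  then have "wcount (Suc k) = (\<lambda>m p. ucount (Suc k) m p + ucount k m p)" by blast
  then show ?thesis by (simp add: bi_fps_add[symmetric])
qed

text \<open>The series \<open>1 / ((1 - A) (1 - B))\<close>.\<close>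

definition "geo2 = bi_fps a b (wcount 0)"

lemma bi_fps_wcount: "bi_fps a b (wcount k) = (geo2 - 1) ^ k * geo2"
proof (induction k)
  case 0
  show ?case by (simp add: geo2_def)
next
  case (Suc k)
  let ?W = "\<lambda>k. bi_fps a b (wcount k)"
  define L where "L = lin_factor"
  have "?W (Suc k) = (1 - L) * ?W (Suc k) + (1 - L) * ?W k"
    unfolding L_def by (subst bi_fps_wcount_Suc) (simp only: bi_fps_ucount)
  then have 1: "L * ?W (Suc k) = (1 - L) * ?W k"
    by (simp add: algebra_simps)
  have 2: "L * geo2 = 1" using bi_fps_wcount_0 by (simp add: geo2_def L_def)
  have "?W (Suc k) = (L * geo2) * ?W (Suc k)"
    by (simp only: 2 mult_1)
  also have "\<dots> = geo2 * (L * ?W (Suc k))"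
    by (simp only: mult_ac)
  also have "\<dots> = (geo2 - L * geo2) * ?W k"
    unfolding 1 by (simp add: algebra_simps)
  also have "\<dots> = (geo2 - 1) ^ Suc k * geo2"
    unfolding 2 Suc by (simp add: mult_ac)
  finally show ?case .
qed

lemma bi_fps_ucount_eq_power: "bi_fps a b (ucount k) = (geo2 - 1) ^ Suc k"
proof -
  have "lin_factor * geo2 = 1" using bi_fps_wcount_0 by (simp add: geo2_def)
  then have "(1 - lin_factor) * geo2 = geo2 - 1" by (simp only: left_diff_distrib) simp
  then show ?thesis unfolding bi_fps_ucount bi_fps_wcount
    by (metis mult.commute mult.left_commute power_Suc)
qed

end

section \<open>Logarithmic derivatives\<close>

text \<open>The coefficients will themselves be power series, so the coefficient ring is not a field, and only
series with constant coefficient 1 are inverted.\<close>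

definition one_over :: "'a::comm_ring_1 fps \<Rightarrow> 'a fps" where
  "one_over f = fps_right_inverse f 1"

lemma one_over: "f $ 0 = 1 \<Longrightarrow> f * one_over f = 1"
  unfolding one_over_def by (rule fps_right_inverse) simp

lemma one_over_nth_0: "one_over f $ 0 = 1"
  by (simp add: one_over_def)

text \<open>For \<open>\<Phi> = 1 / (1 - x U)\<close> one has \<open>\<Phi>' / \<Phi> = x U' / (1 - x U) = \<Sum>\<^sub>k x\<^sup>k\<^sup>+\<^sup>1 U' U\<^sup>k\<close>. After
multiplication by \<open>S\<close>, only the terms with \<open>k < n\<close> contribute to the coefficient of \<open>S\<^sup>n\<close>, which makes each coefficient a finite sum.\<close>

lemma geom_log_deriv:
  fixes x :: "'a::comm_ring_1" and U :: "'a fps"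
  assumes "U $ 0 = 0"
  defines "\<Phi> \<equiv> one_over (1 - fps_const x * U)"
  shows "fps_X * fps_deriv \<Phi> = \<Phi> *
     Abs_fps (\<lambda>n. \<Sum>k<n. x ^ Suc k * (fps_X * (fps_deriv U * U ^ k)) $ n)"
proof -
  let ?c = "fps_const x"
  define N where "N = Abs_fps (\<lambda>n. \<Sum>k<n. x ^ Suc k * (fps_X * (fps_deriv U * U ^ k)) $ n)"
  define M where "M K = (\<Sum>k<K. ?c ^ Suc k * (fps_X * (fps_deriv U * U ^ k)))" for K
  have inv: "(1 - ?c * U) * \<Phi> = 1"
    unfolding \<Phi>_def by (rule one_over) (simp add: assms)
  \<comment> \<open>The partial sums of the geometric series agree with \<open>N\<close> up to degree \<open>K\<close>, so the telescoping
     identity for them determines the product with \<open>N\<close> coefficient by coefficient.\<close>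
  have M: "M K * (1 - ?c * U) = fps_X * (?c * fps_deriv U) - (?c * U) ^ K * fps_X * (?c * fps_deriv U)" for K
  proof (induction K)
    case (Suc K)
    have "M (Suc K) = M K + ?c ^ Suc K * (fps_X * (fps_deriv U * U ^ K))"
      by (simp add: M_def)
    then show ?case
      by (simp only: distrib_right Suc)
        (simp add: algebra_simps power_mult_distrib del: fps_const_mult fps_const_power)
  qed (simp add: M_def)
  have zero: "(U ^ k) $ n = 0" if "n < k" for n k
    using startsby_zero_power_prefix[OF assms(1)] that by blast
  have N_M: "N $ j = M K $ j" if "j \<le> K" for j K
  proof -
    have "M K $ j = (\<Sum>k<K. x ^ Suc k * (fps_X * (fps_deriv U * U ^ k)) $ j)"
      by (simp add: M_def fps_sum_nth fps_const_power del: power_Suc)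
    also have "\<dots> = (\<Sum>k<j. x ^ Suc k * (fps_X * (fps_deriv U * U ^ k)) $ j)"
    proof (rule sum.mono_neutral_right)
      show "\<forall>k\<in>{..<K} - {..<j}. x ^ Suc k * (fps_X * (fps_deriv U * U ^ k)) $ j = 0"
      proof
        fix k assume "k \<in> {..<K} - {..<j}"
        then have "(fps_deriv U * U ^ k) $ (j - 1) = 0" if "j \<noteq> 0"
          using that by (auto simp: fps_mult_nth zero intro!: sum.neutral)
        then show "x ^ Suc k * (fps_X * (fps_deriv U * U ^ k)) $ j = 0"
          by simp
      qed
    qed (use that in auto)
    finally show ?thesis by (simp add: N_def)
  qed
  have N: "N * (1 - ?c * U) = fps_X * (?c * fps_deriv U)"
  proof (rule fps_ext)
    fix n
    have "(N * (1 - ?c * U)) $ n = (M (Suc n) * (1 - ?c * U)) $ n"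
      unfolding fps_mult_nth by (intro sum.cong) (auto simp: N_M[of _ "Suc n"])
    also have "((?c * U) ^ Suc n * fps_X * (?c * fps_deriv U)) $ n = 0"
    proof -
      have "(?c * U) ^ Suc n $ i = 0" if "i < Suc n" for i
        using startsby_zero_power_prefix[of "?c * U" "Suc n"] assms(1) that by simp
      then show ?thesis unfolding mult.assoc fps_mult_nth[of "(?c * U) ^ Suc n"]
        by (intro sum.neutral) auto
    qed
    then have "(M (Suc n) * (1 - ?c * U)) $ n = (fps_X * (?c * fps_deriv U)) $ n"
      unfolding M by simp
    finally show "(N * (1 - ?c * U)) $ n = (fps_X * (?c * fps_deriv U)) $ n" .
  qed
  have "fps_deriv ((1 - ?c * U) * \<Phi>) = 0" unfolding inv by simp
  then have d: "(1 - ?c * U) * fps_deriv \<Phi> = ?c * fps_deriv U * \<Phi>"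
    by (simp add: algebra_simps del: fps_const_mult)
  have "fps_X * fps_deriv \<Phi> = (\<Phi> * fps_X) * ((1 - ?c * U) * fps_deriv \<Phi>)"
  proof -
    have "fps_X * fps_deriv \<Phi> = ((1 - ?c * U) * \<Phi>) * (fps_X * fps_deriv \<Phi>)"
      unfolding inv by simp
    then show ?thesis by (simp only: mult_ac)
  qed
  also have "\<dots> = \<Phi> * (N * (1 - ?c * U)) * \<Phi>"
    unfolding d N by (simp add: mult_ac del: fps_const_mult)
  also have "\<dots> = \<Phi> * N * ((1 - ?c * U) * \<Phi>)"
    by (simp only: mult_ac)
  finally show ?thesis using inv by (simp add: N_def)
qed

lemma log_deriv_prod:
  fixes f :: "'i \<Rightarrow> 'a::comm_ring_1 fps"
  assumes "finite I" "\<And>i. i \<in> I \<Longrightarrow> fps_X * fps_deriv (f i) = f i * N i"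
  shows "fps_X * fps_deriv (\<Prod>i\<in>I. f i) = (\<Prod>i\<in>I. f i) * (\<Sum>i\<in>I. N i)"
  using assms
proof (induction rule: finite_induct)
  case (insert i I)
  have "fps_X * fps_deriv (\<Prod>i\<in>insert i I. f i) =
    (fps_X * fps_deriv (f i)) * prod f I + f i * (fps_X * fps_deriv (prod f I))"
    using insert.hyps by (simp add: algebra_simps)
  also have "\<dots> = (\<Prod>i\<in>insert i I. f i) * (\<Sum>i\<in>insert i I. N i)"
    using insert by (simp add: algebra_simps)
  finally show ?case .
qed simp

section \<open>Sums over partitions\<close>

text \<open>The complete homogeneous symmetric function \<open>h\<^sub>n\<close> written in terms of power sums \<open>p\<^sub>i\<close>, which are
arbitrary here.\<close>

definition complete_homogeneous :: "(nat \<Rightarrow> real fps) \<Rightarrow> nat \<Rightarrow> real fps" where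
  "complete_homogeneous p n =
     (\<Sum>mu\<in>partitions_of n. fps_const (1 / real (zpart mu)) * prod_list (map p mu))"

lemma partitions_of_0: "partitions_of 0 = {[]}"
proof -
  have "mu = []" if "is_partition mu" "weight mu = 0" for mu
    using that by (cases mu) (auto simp: is_partition_def)
  then show ?thesis by (auto simp: partitions_of_def is_partition_def)
qed

text \<open>Adding a part to a partition, or removing one, is done on the multiset of parts; this function
recovers the weakly decreasing list.\<close>

definition desc :: "nat list \<Rightarrow> nat list" where
  "desc xs = rev (sort xs)"

lemma mset_desc [simp]: "mset (desc xs) = mset xs"
  by (simp add: desc_def)

lemma set_desc [simp]: "set (desc xs) = set xs"
  by (simp add: desc_def)

lemma weight_desc [simp]: "weight (desc xs) = weight xs"
  unfolding sum_mset_sum_list[symmetric] mset_desc ..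

lemma sorted_wrt_desc [simp]: "sorted_wrt (\<ge>) (desc xs)"
  by (simp add: desc_def sorted_wrt_rev)

lemma desc_eqI:
  assumes "is_partition mu" "mset xs = mset mu"
  shows "desc xs = mu"
proof -
  have "sorted (rev mu)"
    using assms(1) by (simp add: is_partition_def sorted_wrt_rev)
  then have "sort xs = rev mu"
    by (intro properties_for_sort) (use assms(2) in simp_all)
  then show ?thesis by (simp add: desc_def)
qed

lemma zpart_superset:
  assumes "finite A" "set mu \<subseteq> A"
  shows "zpart mu = (\<Prod>i\<in>A. i ^ mult mu i * fact (mult mu i))"
  unfolding zpart_def by (rule prod.mono_neutral_left) (use assms in auto)

lemma zpart_mset_cong: "mset xs = mset ys \<Longrightarrow> zpart xs = zpart ys"
  unfolding zpart_def set_mset_mset[symmetric] count_mset[symmetric] by simp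

lemma zpart_Cons: "zpart (i # mu) = i * mult (i # mu) i * zpart mu"
proof -
  let ?A = "insert i (set mu)"
  have "zpart (i # mu) = (\<Prod>j\<in>?A. (if j = i then i * mult (i # mu) i else 1) * (j ^ mult mu j * fact (mult mu j)))"
    by (subst zpart_superset[of ?A])
      (auto intro!: prod.cong simp: algebra_simps
        simp del: mult_cancel1 mult_cancel2 mult_cancel_left mult_cancel_right)
  also have "\<dots> = i * mult (i # mu) i * zpart mu"
    unfolding prod.distrib zpart_superset[of ?A mu, OF finite.insertI[OF finite_set] subset_insertI]
    by simp
  finally show ?thesis .
qed

lemma zpart_pos: "is_partition mu \<Longrightarrow> 0 < zpart mu"
  by (auto simp: zpart_def is_partition_def intro!: prod_pos)

lemma weight_eq_sum_mult: "weight mu = (\<Sum>i\<in>set mu. i * mult mu i)"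
  using sum_list_map_eq_sum_count[of "\<lambda>i. i" mu] by (simp add: mult.commute)

text \<open>Marking one part \<open>i\<close> of \<open>\<mu>\<close> with weight \<open>i m\<^sub>i(\<mu>)\<close> counts \<open>\<mu>\<close> exactly \<open>|\<mu>| = n\<close> times. Removing the
marked part leaves a partition \<open>\<nu>\<close> of \<open>n - i\<close>, and \<open>z\<^sub>\<mu> = i m\<^sub>i(\<mu>) z\<^sub>\<nu>\<close> absorbs the weight.\<close>

lemma complete_homogeneous_rec:
  "of_nat n * complete_homogeneous p n = (\<Sum>i=1..n. p i * complete_homogeneous p (n - i))"
proof -
  let ?t = "\<lambda>mu. fps_const (1 / real (zpart mu)) * prod_list (map p mu)"
  have pl: "prod_list (map p xs) = prod_list (map p ys)" if "mset xs = mset ys" for xs ys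
    unfolding prod_mset_prod_list[symmetric] mset_map that ..
  have key: "fps_const (real (i * mult mu i)) * ?t mu = p i * ?t nu"
    if "is_partition mu" "mset mu = mset (i # nu)" for mu nu i
  proof -
    have "mult mu i = mult (i # nu) i"
      using that(2) by (simp only: count_mset[symmetric])
    then have "zpart mu = i * mult mu i * zpart nu"
      using zpart_mset_cong[OF that(2)] zpart_Cons[of i nu] by simp
    moreover have "0 < zpart mu" using that zpart_pos by blast
    ultimately have "real (i * mult mu i) * (1 / real (zpart mu)) = 1 / real (zpart nu)"
      by simp
    moreover have "prod_list (map p mu) = p i * prod_list (map p nu)"
      using pl[OF that(2)] by simp
    moreover have "fps_const (real (i * mult mu i)) * ?t mu =
        fps_const (real (i * mult mu i) * (1 / real (zpart mu))) * prod_list (map p mu)"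
      unfolding fps_const_mult[symmetric] mult.assoc ..
    ultimately show ?thesis
      by (simp only: mult.left_commute[of "p i"])
  qed
  have "of_nat n * complete_homogeneous p n
      = (\<Sum>mu\<in>partitions_of n. fps_const (real (weight mu)) * ?t mu)"
    unfolding complete_homogeneous_def sum_distrib_left
    by (rule sum.cong) (auto simp: partitions_of_def fps_of_nat)
  also have "\<dots> = (\<Sum>mu\<in>partitions_of n. \<Sum>i\<in>set mu. fps_const (real (i * mult mu i)) * ?t mu)"
  proof (rule sum.cong[OF refl])
    fix mu
    have "fps_const (real (weight mu)) = (\<Sum>i\<in>set mu. fps_const (real (i * mult mu i)))"
      unfolding weight_eq_sum_mult by (rule fps_ext) (simp add: fps_sum_nth)
    then show "fps_const (real (weight mu)) * ?t mu = (\<Sum>i\<in>set mu. fps_const (real (i * mult mu i)) * ?t mu)"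
      by (simp only: sum_distrib_right)
  qed
  also have "\<dots> = (\<Sum>(mu, i)\<in>(SIGMA mu:partitions_of n. set mu). fps_const (real (i * mult mu i)) * ?t mu)"
    by (rule sum.Sigma) (auto simp: finite_partitions_of)
  also have "\<dots> = (\<Sum>(i, nu)\<in>(SIGMA i:{1..n}. partitions_of (n - i)). p i * ?t nu)"
  proof (rule sum.reindex_bij_witness[of _ "\<lambda>(i, nu). (desc (i # nu), i)" "\<lambda>(mu, i). (i, desc (remove1 i mu))"], goal_cases)
    case (1 a)
    then obtain mu i where a: "a = (mu, i)" "is_partition mu" "weight mu = n" "i \<in> set mu"
      by (auto simp: partitions_of_def)
    then have "desc (i # desc (remove1 i mu)) = mu"
      by (intro desc_eqI) simp_all
    with a show ?case by simp
  next
    case (2 a)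
    then obtain mu i where a: "a = (mu, i)" "is_partition mu" "weight mu = n" "i \<in> set mu"
      by (auto simp: partitions_of_def)
    then have "1 \<le> i" by (auto simp: is_partition_def Suc_le_eq)
    moreover have "weight mu = i + weight (remove1 i mu)"
      using sum_list_map_remove1[OF a(4), of "\<lambda>x. x"] by simp
    moreover have "is_partition (desc (remove1 i mu))"
      using a(2) by (auto simp: is_partition_def dest: notin_set_remove1)
    ultimately show ?case using a by (auto simp: partitions_of_def)
  next
    case (3 b)
    then obtain i nu where b: "b = (i, nu)" "is_partition nu" "1 \<le> i" "i \<le> n" "weight nu = n - i"
      by (auto simp: partitions_of_def)
    then have "desc (remove1 i (desc (i # nu))) = nu"
      by (intro desc_eqI) simp_all
    with b show ?case by simp
  next
    case (4 b)
    then show ?case by (auto simp: partitions_of_def is_partition_def)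
  next
    case (5 a)
    then obtain mu i where a: "a = (mu, i)" "is_partition mu" "i \<in> set mu"
      by (auto simp: partitions_of_def)
    then show ?case using key[of mu i "desc (remove1 i mu)"] by simp
  qed
  also have "\<dots> = (\<Sum>i=1..n. \<Sum>nu\<in>partitions_of (n - i). p i * ?t nu)"
    by (rule sum.Sigma[symmetric]) (auto simp: finite_partitions_of)
  finally show ?thesis
    by (simp add: complete_homogeneous_def sum_distrib_left)
qed

text \<open>The recurrence says that the generating function of the \<open>h\<^sub>n\<close> has logarithmic derivative
\<open>\<Sum>\<^sub>n p\<^sub>n S\<^sup>n\<^sup>-\<^sup>1\<close>. In characteristic 0 this and the constant coefficient determine it.\<close>

lemma complete_homogeneous_unique:
  fixes Q :: "real fps fps"
  assumes "Q $ 0 = 1" and "fps_X * fps_deriv Q = Q * Abs_fps (\<lambda>n. if n = 0 then 0 else p n)"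
  shows "Q $ n = complete_homogeneous p n"
proof (induction n rule: less_induct)
  case (less n)
  show ?case
  proof (cases "n = 0")
    case True
    then show ?thesis
      by (simp add: assms complete_homogeneous_def partitions_of_0 zpart_def)
  next
    case False
    have "of_nat n * Q $ n = (fps_X * fps_deriv Q) $ n"
      using False by simp
    also have "\<dots> = (\<Sum>i\<le>n. (if i = 0 then 0 else p i) * Q $ (n - i))"
      unfolding assms(2) by (simp add: mult.commute[of Q] fps_mult_nth atMost_atLeast0)
    also have "\<dots> = (\<Sum>i=1..n. p i * Q $ (n - i))"
      by (rule sum.mono_neutral_cong_right) auto
    also have "\<dots> = of_nat n * complete_homogeneous p n"
      unfolding complete_homogeneous_rec by (intro sum.cong) (use less in auto)
    finally show ?thesis using False by simp
  qed
qed

section \<open>Sums over decompositions of the parts\<close>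

lemma binom_of_nat: "binom (real a) (int b) = real (a choose b)"
  by (simp add: binom_def binomial_gbinomial)

lemma nbinom_eq_ucount:
  assumes "p \<le> n" "0 < n"
  shows "nbinom n p (Suc k) = real n / real (Suc k) * real (ucount k (n - p) p)"
proof -
  have "(\<Sum>r\<le>p. binom (real p) (int r) * binom (real n - real p) (int r)
             * binom (real n - real r - 1) (int (Suc k) - int r - 1))
    = (\<Sum>r\<le>k. real ((p choose r) * (n - p choose r) * (n - 1 - r choose (k - r))))"
  proof (rule sum.mono_neutral_cong)
    fix r assume "r \<in> {..p} \<inter> {..k}"
    then have r: "r \<le> p" "r \<le> k" by auto
    show "binom (real p) (int r) * binom (real n - real p) (int r)
             * binom (real n - real r - 1) (int (Suc k) - int r - 1)
       = real ((p choose r) * (n - p choose r) * (n - 1 - r choose (k - r)))"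
    proof (cases "r \<le> n - p")
      case True
      then have "Suc r \<le> n" using r assms by linarith
      then have "real n - real r - 1 = real (n - 1 - r)"
        by (simp add: of_nat_diff)
      moreover have "real n - real p = real (n - p)"
        using assms by (simp add: of_nat_diff)
      moreover have "int (Suc k) - int r - 1 = int (k - r)"
        using r by (simp add: of_nat_diff)
      ultimately show ?thesis
        by (simp only: binom_of_nat of_nat_mult)
    next
      case False
      have "real n - real p = real (n - p)"
        using assms(1) by simp
      with False show ?thesis
        by (simp only: binom_of_nat of_nat_mult) (simp add: binomial_eq_0)
    qed
  qed (auto simp: binom_def)
  then show ?thesis using assms by (simp add: nbinom_def ucount_def)
qed

lemma nbinom_0: "nbinom n p 0 = 0"
  by (simp add: nbinom_def)

lemma nbinom_eq_0:
  assumes "p \<le> n" "n < k"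
  shows "nbinom n p k = 0"
proof (cases "n = 0")
  case True
  then show ?thesis by (simp add: nbinom_def)
next
  case False
  obtain k' where k: "k = Suc k'" using assms by (cases k) auto
  have "ucount k' (n - p) p = 0"
    using assms False by (auto simp: ucount_def k binomial_eq_0)
  then show ?thesis using nbinom_eq_ucount[of p n k'] assms False by (simp add: k)
qed

text \<open>The left-hand side runs over the triangle \<open>i + j \<le> a + b\<close>, which contains the rectangle on which \<open>F\<close>
is supported.\<close>

lemma convolution_sum:
  fixes F :: "nat \<Rightarrow> nat \<Rightarrow> 'a::comm_monoid_add"
  assumes "\<And>i j. i > a \<or> j > b \<Longrightarrow> F i j = 0"
  shows "(\<Sum>q\<le>a + b. \<Sum>i\<le>q. F i (q - i)) = (\<Sum>i\<le>a. \<Sum>j\<le>b. F i j)"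
proof -
  have "(\<Sum>q\<le>a + b. \<Sum>i\<le>q. F i (q - i)) = (\<Sum>(i, j)\<in>{(i, j). i + j \<le> a + b}. F i j)"
    by (rule sum.triangle_reindex_eq[symmetric])
  also have "\<dots> = (\<Sum>(i, j)\<in>{..a} \<times> {..b}. F i j)"
  proof (rule sum.mono_neutral_right)
    show "finite {(i, j). i + j \<le> a + b}"
      by (rule finite_subset[of _ "{..a + b} \<times> {..a + b}"]) auto
  qed (auto simp: not_le intro: assms)
  finally show ?thesis by (simp add: sum.cartesian_product)
qed

lemma sum_decomp_below_Cons:
  "(\<Sum>ps\<in>decomp_below (m # mu) p. f ps) =
   (\<Sum>p1\<le>p. if p1 \<le> m then (\<Sum>ps\<in>decomp_below mu (p - p1). f (p1 # ps)) else 0)"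
proof -
  have iff: "ps \<in> decomp_below mu p \<longleftrightarrow> list_all2 (\<le>) ps mu \<and> sum_list ps = p" for ps mu p
  proof -
    have "(\<forall>i. 1 \<le> i \<and> i \<le> length mu \<longrightarrow> part ps i \<le> part mu i) \<longleftrightarrow> (\<forall>i<length mu. ps ! i \<le> mu ! i)"
    proof (intro iffI allI impI, goal_cases)
      case (1 i)
      then show ?case using spec[OF 1(1), of "Suc i"] by (simp add: Defs.part_def)
    next
      case (2 i)
      then show ?case by (auto simp: Defs.part_def)
    qed
    then show ?thesis by (auto simp: decomp_below_def list_all2_conv_all_nth)
  qed
  have "(\<Sum>p1\<le>p. if p1 \<le> m then (\<Sum>ps\<in>decomp_below mu (p - p1). f (p1 # ps)) else 0)
    = (\<Sum>p1\<in>{..p} \<inter> {..m}. \<Sum>ps\<in>decomp_below mu (p - p1). f (p1 # ps))"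
    by (simp add: sum.If_cases atMost_def)
  also have "\<dots> = (\<Sum>(p1, ps)\<in>(SIGMA p1:{..p} \<inter> {..m}. decomp_below mu (p - p1)). f (p1 # ps))"
    by (rule sum.Sigma) (auto simp: finite_decomp_below)
  also have "\<dots> = (\<Sum>ps\<in>decomp_below (m # mu) p. f ps)"
    by (rule sum.reindex_bij_witness[of _ "\<lambda>xs. (hd xs, tl xs)" "\<lambda>(p1, ps). p1 # ps"])
      (auto simp: iff list_all2_Cons2)
  finally show ?thesis ..
qed

lemma sum_decomp_pos_Suc:
  "(\<Sum>ks\<in>decomp_pos (Suc l) k. f ks) =
   (\<Sum>k1\<le>k. if 1 \<le> k1 then (\<Sum>ks\<in>decomp_pos l (k - k1). f (k1 # ks)) else 0)"
proof -
  have "(\<Sum>k1\<le>k. if 1 \<le> k1 then (\<Sum>ks\<in>decomp_pos l (k - k1). f (k1 # ks)) else 0)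
    = (\<Sum>k1\<in>{..k} \<inter> {1..}. \<Sum>ks\<in>decomp_pos l (k - k1). f (k1 # ks))"
    by (simp add: sum.If_cases atLeast_def)
  also have "\<dots> = (\<Sum>(k1, ks)\<in>(SIGMA k1:{..k} \<inter> {1..}. decomp_pos l (k - k1)). f (k1 # ks))"
    by (rule sum.Sigma) (auto simp: finite_decomp_pos)
  also have "\<dots> = (\<Sum>ks\<in>decomp_pos (Suc l) k. f ks)"
    by (rule sum.reindex_bij_witness[of _ "\<lambda>xs. (hd xs, tl xs)" "\<lambda>(p1, ps). p1 # ps"])
      (auto simp: decomp_pos_def length_Suc_conv)
  finally show ?thesis ..
qed

text \<open>For \<open>p > m\<close> the formula for \<open>nbinom m p k\<close> has the negative upper entry \<open>m - p\<close> and need not vanish;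
decompositions with such a part are excluded.\<close>

definition nbinom0 :: "nat \<Rightarrow> nat \<Rightarrow> nat \<Rightarrow> real" where
  "nbinom0 m p k = (if p \<le> m then nbinom m p k else 0)"

lemma nbinom0_eq_0: "p > m \<or> k > m \<Longrightarrow> nbinom0 m p k = 0"
  using nbinom_eq_0 by (auto simp: nbinom0_def)

lemma abinom_Nil: "abinom [] p k = (if p = 0 \<and> k = 0 then 1 else 0)"
proof -
  have "decomp_below [] p = (if p = 0 then {[]} else {})" "decomp_pos 0 k = (if k = 0 then {[]} else {})"
    by (auto simp: decomp_below_def decomp_pos_def)
  then show ?thesis by (simp add: abinom_def)
qed

lemma abinom_Cons:
  "abinom (m # mu) p k = (\<Sum>p1\<le>p. \<Sum>k1\<le>k. nbinom0 m p1 k1 * abinom mu (p - p1) (k - k1))"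
proof -
  let ?P = "\<lambda>mu ps ks. \<Prod>i=1..length mu. nbinom (part mu i) (part ps i) (part ks i)"
  have P: "?P (m # mu) (p1 # ps) (k1 # ks) = nbinom m p1 k1 * ?P mu ps ks" for p1 ps k1 ks
    by (simp only: One_nat_def prod.atLeast1_atMost_eq length_Cons prod.lessThan_Suc_shift Defs.part_def) simp
  have "abinom (m # mu) p k = (\<Sum>p1\<le>p. if p1 \<le> m then \<Sum>ps\<in>decomp_below mu (p - p1).
      \<Sum>k1\<le>k. if 1 \<le> k1 then \<Sum>ks\<in>decomp_pos (length mu) (k - k1). nbinom m p1 k1 * ?P mu ps ks else 0 else 0)"
    unfolding abinom_def list.size(4) One_nat_def add_Suc_right add_0_right sum_decomp_below_Cons sum_decomp_pos_Suc
    by (simp only: P[unfolded list.size(4) One_nat_def add_Suc_right add_0_right])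
  also have "\<dots> = (\<Sum>p1\<le>p. \<Sum>k1\<le>k. nbinom0 m p1 k1 * abinom mu (p - p1) (k - k1))"
  proof (rule sum.cong[OF refl], goal_cases)
    case (1 p1)
    have "(\<Sum>ps\<in>decomp_below mu (p - p1).
      \<Sum>k1\<le>k. if 1 \<le> k1 then \<Sum>ks\<in>decomp_pos (length mu) (k - k1). nbinom m p1 k1 * ?P mu ps ks else 0)
      = (\<Sum>k1\<le>k. nbinom m p1 k1 * abinom mu (p - p1) (k - k1))"
      unfolding abinom_def sum_distrib_left
      by (subst sum.swap, intro sum.cong refl) (auto simp: nbinom_0 not_le)
    then show ?case by (simp add: nbinom0_def)
  qed
  finally show ?thesis .
qed

lemma abinom_eq_0: "p > weight mu \<or> k > weight mu \<Longrightarrow> abinom mu p k = 0"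
proof (induction mu arbitrary: p k)
  case Nil
  then show ?case by (auto simp: abinom_Nil)
next
  case (Cons m mu)
  have "nbinom0 m p1 k1 * abinom mu (p - p1) (k - k1) = 0" if "p1 \<le> p" "k1 \<le> k" for p1 k1
  proof (cases "p1 > m \<or> k1 > m")
    case True
    then show ?thesis by (simp add: nbinom0_eq_0)
  next
    case False
    then have "p - p1 > weight mu \<or> k - k1 > weight mu" using Cons.prems by auto
    then show ?thesis by (simp add: Cons.IH)
  qed
  then show ?case unfolding abinom_Cons by (intro sum.neutral ballI) auto
qed

context
  fixes x y :: "real fps"
begin

text \<open>The power sum \<open>p\<^sub>n\<close> of the introduction without its factor \<open>d\<^sub>n(\<lambda>)\<close>.\<close>

definition part_series :: "nat \<Rightarrow> real fps" where
  "part_series n = (\<Sum>p\<le>n. \<Sum>k\<le>n. fps_const (nbinom n p k) * (y ^ p * x ^ k))"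

text \<open>This is what the sum over decompositions of \<open>p\<close> and \<open>k\<close> is made for: it is the coefficient
extraction from a product over the parts.\<close>

lemma prod_part_series:
  "prod_list (map part_series mu) =
     (\<Sum>q\<le>weight mu. \<Sum>k\<le>weight mu. fps_const (abinom mu q k) * (y ^ q * x ^ k))"
proof (induction mu)
  case Nil
  show ?case by (simp add: abinom_Nil)
next
  case (Cons m mu)
  let ?b = "weight mu"
  define H where "H i i' j j' = (fps_const (nbinom0 m i j) * (y ^ i * x ^ j)) *
      (fps_const (abinom mu i' j') * (y ^ i' * x ^ j'))" for i i' j j'
  have H0: "H i i' j j' = 0" if "i > m \<or> i' > ?b \<or> j > m \<or> j' > ?b" for i i' j j'
    using that nbinom0_eq_0[of m i j] abinom_eq_0[of mu i' j'] by (auto simp: H_def)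
  have "(\<Sum>q\<le>m + ?b. \<Sum>k\<le>m + ?b. fps_const (abinom (m # mu) q k) * (y ^ q * x ^ k))
    = (\<Sum>q\<le>m + ?b. \<Sum>k\<le>m + ?b. \<Sum>i\<le>q. \<Sum>j\<le>k. H i (q - i) j (k - j))"
  proof (intro sum.cong refl)
    fix q k
    have "fps_const (abinom (m # mu) q k) * (y ^ q * x ^ k)
       = (\<Sum>i\<le>q. \<Sum>j\<le>k. fps_const (nbinom0 m i j * abinom mu (q - i) (k - j)) * (y ^ q * x ^ k))"
      unfolding abinom_Cons sum_distrib_right[symmetric]
      by (intro arg_cong2[of _ _ _ _ "(*)"] refl fps_ext) (simp add: fps_sum_nth)
    also have "\<dots> = (\<Sum>i\<le>q. \<Sum>j\<le>k. H i (q - i) j (k - j))"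
    proof (intro sum.cong refl)
      fix i j assume "i \<in> {..q}" "j \<in> {..k}"
      then have "y ^ q = y ^ i * y ^ (q - i)" "x ^ k = x ^ j * x ^ (k - j)"
        by (simp_all flip: power_add)
      then show "fps_const (nbinom0 m i j * abinom mu (q - i) (k - j)) * (y ^ q * x ^ k) = H i (q - i) j (k - j)"
        unfolding H_def fps_const_mult[symmetric] by (simp only: mult_ac)
    qed
    finally show "fps_const (abinom (m # mu) q k) * (y ^ q * x ^ k) = (\<Sum>i\<le>q. \<Sum>j\<le>k. H i (q - i) j (k - j))" .
  qed
  also have "\<dots> = (\<Sum>q\<le>m + ?b. \<Sum>i\<le>q. \<Sum>k\<le>m + ?b. \<Sum>j\<le>k. H i (q - i) j (k - j))"
    by (intro sum.cong refl sum.swap)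
  also have "\<dots> = (\<Sum>i\<le>m. \<Sum>i'\<le>?b. \<Sum>k\<le>m + ?b. \<Sum>j\<le>k. H i i' j (k - j))"
    by (rule convolution_sum) (auto simp: H0 intro!: sum.neutral)
  also have "\<dots> = (\<Sum>i\<le>m. \<Sum>i'\<le>?b. \<Sum>j\<le>m. \<Sum>j'\<le>?b. H i i' j j')"
    by (intro sum.cong refl convolution_sum) (auto simp: H0)
  also have "\<dots> = (\<Sum>i\<le>m. \<Sum>j\<le>m. \<Sum>i'\<le>?b. \<Sum>j'\<le>?b. H i i' j j')"
    by (intro sum.cong refl sum.swap)
  also have "\<dots> = part_series m * prod_list (map part_series mu)"
    unfolding Cons.IH part_series_def H_def sum_product[symmetric] sum_distrib_left[symmetric] sum_distrib_right[symmetric]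
    by (intro arg_cong2[of _ _ _ _ "(*)"] sum.cong refl) (simp add: nbinom0_def)
  finally show ?case by simp
qed

section \<open>The generating function of the sums over partitions\<close>

definition cell_series :: "real \<Rightarrow> real fps fps" where
  "cell_series c = one_over (1 - fps_const x * (geo2 (fps_const c) (fps_const c * y) - 1))"

lemma geo2_nth_0: "geo2 a b $ 0 = 1"
  by (simp add: geo2_def bi_fps_nth wcount_def)

text \<open>The coefficient of \<open>S\<^sup>n\<close> in \<open>S U' U\<^sup>k = S (U\<^sup>k\<^sup>+\<^sup>1)' / (k + 1)\<close> is \<open>n / (k + 1)\<close> times that of
\<open>U\<^sup>k\<^sup>+\<^sup>1\<close>. This accounts for the factor \<open>n / k\<close> in the definition of \<open>nbinom\<close>.\<close>

lemma cell_log_deriv: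
  "fps_X * fps_deriv (cell_series c) =
     cell_series c * Abs_fps (\<lambda>n. if n = 0 then 0 else fps_const (c ^ n) * part_series n)"
proof -
  define U where "U = geo2 (fps_const c) (fps_const c * y) - 1"
  have U0: "U $ 0 = 0" by (simp add: U_def geo2_nth_0)
  have U: "U ^ Suc k $ n = fps_const (c ^ n) * (\<Sum>p\<le>n. of_nat (ucount k (n - p) p) * y ^ p)" for k n
  proof -
    have "U ^ Suc k $ n = (\<Sum>p\<le>n. of_nat (ucount k (n - p) p) * fps_const c ^ (n - p) * (fps_const c * y) ^ p)"
      unfolding U_def bi_fps_ucount_eq_power[symmetric] bi_fps_nth ..
    also have "\<dots> = (\<Sum>p\<le>n. fps_const (c ^ n) * (of_nat (ucount k (n - p) p) * y ^ p))"
    proof (rule sum.cong[OF refl])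
      fix p assume "p \<in> {..n}"
      then have "fps_const (c ^ n) = fps_const c ^ (n - p) * fps_const c ^ p"
        by (simp add: fps_const_power flip: power_add)
      then show "of_nat (ucount k (n - p) p) * fps_const c ^ (n - p) * (fps_const c * y) ^ p =
         fps_const (c ^ n) * (of_nat (ucount k (n - p) p) * y ^ p)"
        by (simp only: power_mult_distrib mult_ac)
    qed
    finally show ?thesis by (simp add: sum_distrib_left)
  qed
  have coeff: "(fps_X * (fps_deriv U * U ^ k)) $ n =
     fps_const (c ^ n) * (\<Sum>p\<le>n. fps_const (nbinom n p (Suc k)) * y ^ p)" if "0 < n" for n k
  proof -
    have "of_nat (Suc k) * (fps_X * (fps_deriv U * U ^ k)) $ n
       = (fps_X * fps_deriv (U ^ Suc k)) $ n"
      unfolding fps_deriv_power' by (cases n) (simp_all add: mult.assoc fps_of_nat[symmetric] del: power_Suc of_nat_Suc)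
    also have "\<dots> = of_nat n * U ^ Suc k $ n"
      using that by (simp del: power_Suc)
    also have "\<dots> = fps_const (c ^ n) * (\<Sum>p\<le>n. of_nat n * of_nat (ucount k (n - p) p) * y ^ p)"
      unfolding U by (simp add: sum_distrib_left mult_ac)
    also have "\<dots> = fps_const (c ^ n) * (\<Sum>p\<le>n. of_nat (Suc k) * (fps_const (nbinom n p (Suc k)) * y ^ p))"
    proof (rule arg_cong2[of _ _ _ _ "(*)", OF refl], rule sum.cong[OF refl])
      fix p assume "p \<in> {..n}"
      then have "real n * real (ucount k (n - p) p) = real (Suc k) * nbinom n p (Suc k)"
        using that by (subst nbinom_eq_ucount) auto
      then have "(of_nat n * of_nat (ucount k (n - p) p) :: real fps) = of_nat (Suc k) * fps_const (nbinom n p (Suc k))"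
        unfolding fps_of_nat[symmetric] fps_const_mult by simp
      then show "of_nat n * of_nat (ucount k (n - p) p) * y ^ p = of_nat (Suc k) * (fps_const (nbinom n p (Suc k)) * y ^ p)"
        unfolding mult.assoc[symmetric] by (rule arg_cong)
    qed
    also have "\<dots> = of_nat (Suc k) * (fps_const (c ^ n) * (\<Sum>p\<le>n. fps_const (nbinom n p (Suc k)) * y ^ p))"
      by (simp only: sum_distrib_left[symmetric] mult.left_commute)
    finally show ?thesis
      by (simp only: mult_cancel_left of_nat_eq_0_iff) simp
  qed
  have "(\<Sum>k<n. x ^ Suc k * (fps_X * (fps_deriv U * U ^ k)) $ n) =
     (if n = 0 then 0 else fps_const (c ^ n) * part_series n)" for n
  proof (cases "n = 0")
    case False
    have "(\<Sum>k<n. x ^ Suc k * (fps_X * (fps_deriv U * U ^ k)) $ n)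
       = (\<Sum>k<n. fps_const (c ^ n) * (\<Sum>p\<le>n. fps_const (nbinom n p (Suc k)) * (y ^ p * x ^ Suc k)))"
      using False by (intro sum.cong refl) (simp only: coeff sum_distrib_left mult_ac neq0_conv)
    also have "\<dots> = fps_const (c ^ n) * (\<Sum>p\<le>n. \<Sum>k<n. fps_const (nbinom n p (Suc k)) * (y ^ p * x ^ Suc k))"
      unfolding sum_distrib_left[symmetric] by (subst sum.swap) simp
    also have "(\<Sum>p\<le>n. \<Sum>k<n. fps_const (nbinom n p (Suc k)) * (y ^ p * x ^ Suc k)) = part_series n"
      unfolding part_series_def
      by (rule sum.cong[OF refl]) (simp add: sum.atMost_shift nbinom_0 del: power_Suc)
    finally show ?thesis using False by simp
  qed simp
  then show ?thesis
    using geom_log_deriv[OF U0, of x] by (simp add: cell_series_def U_def)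
qed

text \<open>Summing the logarithmic derivatives of the factors over the cells turns \<open>c\<^sup>n\<close> into \<open>d\<^sub>n(\<lambda>)\<close>.\<close>

lemma prod_cell_series_nth:
  "(\<Prod>(i, j)\<in>diagram lam. cell_series (content \<alpha> i j)) $ n =
     (\<Sum>q\<le>n. \<Sum>k\<le>n. fps_const (Ffun \<alpha> n q k lam) * (y ^ q * x ^ k))"
proof -
  let ?Q = "\<Prod>(i, j)\<in>diagram lam. cell_series (content \<alpha> i j)"
  define p where "p n = fps_const (dpow \<alpha> n lam) * part_series n" for n
  have "fps_X * fps_deriv ?Q = ?Q * (\<Sum>(i, j)\<in>diagram lam.
     Abs_fps (\<lambda>n. if n = 0 then 0 else fps_const (content \<alpha> i j ^ n) * part_series n))"
    unfolding case_prod_beta by (intro log_deriv_prod finite_diagram cell_log_deriv)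
  also have "(\<Sum>(i, j)\<in>diagram lam.
     Abs_fps (\<lambda>n. if n = 0 then 0 else fps_const (content \<alpha> i j ^ n) * part_series n)) =
     Abs_fps (\<lambda>n. if n = 0 then 0 else p n)"
  proof (rule fps_ext)
    fix n
    have "(\<Sum>(i, j)\<in>diagram lam. fps_const (content \<alpha> i j ^ n) * part_series n) = p n"
      unfolding p_def dpow_def case_prod_beta sum_distrib_right[symmetric]
      by (intro arg_cong2[of _ _ _ _ "(*)"] refl fps_ext) (simp add: fps_sum_nth)
    then show "(\<Sum>(i, j)\<in>diagram lam. Abs_fps (\<lambda>n. if n = 0 then 0 else
        fps_const (content \<alpha> i j ^ n) * part_series n)) $ n = Abs_fps (\<lambda>n. if n = 0 then 0 else p n) $ n"
      by (simp add: fps_sum_nth case_prod_beta)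
  qed
  finally have "fps_X * fps_deriv ?Q = ?Q * Abs_fps (\<lambda>n. if n = 0 then 0 else p n)" .
  moreover have "?Q $ 0 = 1"
  proof -
    have "prod f A $ 0 = 1" if "\<And>a. a \<in> A \<Longrightarrow> f a $ 0 = 1" for f :: "nat \<times> nat \<Rightarrow> real fps fps" and A
      using that by (induction A rule: infinite_finite_induct) auto
    then show ?thesis by (auto simp: cell_series_def one_over_nth_0)
  qed
  ultimately have "?Q $ n = complete_homogeneous p n"
    by (intro complete_homogeneous_unique)
  also have "\<dots> = (\<Sum>mu\<in>partitions_of n. \<Sum>q\<le>n. \<Sum>k\<le>n.
      fps_const (1 / real (zpart mu) * abinom mu q k * dpart \<alpha> mu lam) * (y ^ q * x ^ k))"
    unfolding complete_homogeneous_def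
  proof (rule sum.cong[OF refl])
    fix mu assume "mu \<in> partitions_of n"
    then have w: "weight mu = n" by (simp add: partitions_of_def)
    have pl: "prod_list (map p mu) = fps_const (prod_list (map (\<lambda>i. dpow \<alpha> i lam) mu)) * prod_list (map part_series mu)" for mu
    proof (induction mu)
      case (Cons m mu)
      then show ?case by (simp add: p_def mult_ac flip: fps_const_mult)
    qed simp
    have "prod_list (map (\<lambda>i. dpow \<alpha> i lam) mu) = dpart \<alpha> mu lam"
      unfolding dpart_def prod_mset_prod_list[symmetric] mset_map image_prod_mset_multiplicity
      by (simp add: count_mset)
    then have "prod_list (map p mu) = fps_const (dpart \<alpha> mu lam) *
        (\<Sum>q\<le>n. \<Sum>k\<le>n. fps_const (abinom mu q k) * (y ^ q * x ^ k))"
      unfolding pl prod_part_series w by simp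
    then show "fps_const (1 / real (zpart mu)) * prod_list (map p mu) = (\<Sum>q\<le>n. \<Sum>k\<le>n.
      fps_const (1 / real (zpart mu) * abinom mu q k * dpart \<alpha> mu lam) * (y ^ q * x ^ k))"
      unfolding fps_const_mult[symmetric] by (simp only: sum_distrib_left mult_ac)
  qed
  also have "\<dots> = (\<Sum>q\<le>n. \<Sum>k\<le>n. \<Sum>mu\<in>partitions_of n.
      fps_const (1 / real (zpart mu) * abinom mu q k * dpart \<alpha> mu lam) * (y ^ q * x ^ k))"
    by (subst sum.swap, intro sum.cong refl, subst sum.swap, intro sum.cong refl)
  also have "\<dots> = (\<Sum>q\<le>n. \<Sum>k\<le>n. fps_const (Ffun \<alpha> n q k lam) * (y ^ q * x ^ k))"
  proof (intro sum.cong refl)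
    fix q k
    \<comment> \<open>The values for \<open>k = 0\<close>, a separate case in the definition of \<open>Ffun\<close>, fit the general formula.\<close>
    have "Ffun \<alpha> n q k lam = (\<Sum>mu\<in>partitions_of n. 1 / real (zpart mu) * abinom mu q k * dpart \<alpha> mu lam)"
    proof (cases "k = 0")
      case True
      have z: "abinom mu q 0 = (if mu = [] \<and> q = 0 then 1 else 0)" for mu
        by (cases mu) (auto simp: abinom_Nil abinom_Cons nbinom0_def nbinom_0 intro!: sum.neutral)
      show ?thesis
      proof (cases "n = 0")
        case True
        with \<open>k = 0\<close> show ?thesis
          by (simp add: Ffun_def z partitions_of_0 zpart_def dpart_def)
      next
        case False
        then have "abinom mu q 0 = 0" if "mu \<in> partitions_of n" for mu
          using that by (auto simp: z partitions_of_def)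
        with \<open>k = 0\<close> False show ?thesis by (simp add: Ffun_def)
      qed
    qed (simp add: Ffun_def)
    then show "(\<Sum>mu\<in>partitions_of n. fps_const (1 / real (zpart mu) * abinom mu q k * dpart \<alpha> mu lam) * (y ^ q * x ^ k))
      = fps_const (Ffun \<alpha> n q k lam) * (y ^ q * x ^ k)"
      unfolding sum_distrib_right[symmetric]
      by (intro arg_cong2[of _ _ _ _ "(*)"] refl fps_ext) (simp add: fps_sum_nth)
  qed
  finally show ?thesis .
qed

end

section \<open>Substitution\<close>

text \<open>The substitution of \<open>T\<close>, the variable of the coefficients, for the outer variable \<open>S\<close>.\<close>

definition merge_vars :: "'a::comm_ring_1 fps fps \<Rightarrow> 'a fps" where
  "merge_vars A = Abs_fps (\<lambda>n. \<Sum>i\<le>n. A $ i $ (n - i))"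

lemma merge_vars_nth: "merge_vars A $ n = (\<Sum>i\<le>n. A $ i $ (n - i))"
  by (simp add: merge_vars_def)

lemma merge_vars_diff: "merge_vars (A - B) = merge_vars A - merge_vars B"
  by (rule fps_ext) (simp add: merge_vars_nth sum_subtractf)

lemma merge_vars_mult: "merge_vars (A * B) = merge_vars A * merge_vars B"
proof (rule fps_ext)
  fix n
  have "merge_vars (A * B) $ n =
      (\<Sum>i\<le>n. \<Sum>j\<le>i. \<Sum>l\<le>n - i. A $ j $ l * B $ (i - j) $ (n - i - l))"
    by (simp add: merge_vars_nth fps_mult_nth fps_sum_nth atLeast0AtMost)
  also have "\<dots> = (\<Sum>(i, j, l)\<in>(SIGMA i:{..n}. {..i} \<times> {..n - i}). A $ j $ l * B $ (i - j) $ (n - i - l))"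
    by (simp add: sum.Sigma sum.cartesian_product case_prod_beta)
  also have "\<dots> = (\<Sum>(m, j, i)\<in>(SIGMA m:{..n}. {..m} \<times> {..n - m}). A $ j $ (m - j) * B $ i $ (n - m - i))"
    by (rule sum.reindex_bij_witness[of _ "\<lambda>(m, j, i). (i + j, j, m - j)" "\<lambda>(i, j, l). (j + l, j, i - j)"]) (auto simp: add.commute)
  also have "\<dots> = (\<Sum>m\<le>n. \<Sum>j\<le>m. \<Sum>i\<le>n - m. A $ j $ (m - j) * B $ i $ (n - m - i))"
    by (simp add: sum.Sigma sum.cartesian_product case_prod_beta)
  also have "\<dots> = (merge_vars A * merge_vars B) $ n"
    by (simp add: merge_vars_nth fps_mult_nth atLeast0AtMost sum_product)
  finally show "merge_vars (A * B) $ n = (merge_vars A * merge_vars B) $ n" .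
qed

lemma merge_vars_const: "merge_vars (fps_const a) = a"
proof (rule fps_ext)
  fix n
  have "merge_vars (fps_const a) $ n = (\<Sum>i\<in>{0}. fps_const a $ i $ (n - i))"
    unfolding merge_vars_nth by (rule sum.mono_neutral_right) auto
  then show "merge_vars (fps_const a) $ n = a $ n" by simp
qed

lemma merge_vars_1: "merge_vars 1 = 1"
  using merge_vars_const[of 1] by simp

lemma merge_vars_X: "merge_vars (fps_X :: 'a::comm_ring_1 fps fps) = fps_X"
proof (rule fps_ext)
  fix n
  show "merge_vars (fps_X :: 'a fps fps) $ n = fps_X $ n"
  proof (cases n)
    case (Suc k)
    have "merge_vars (fps_X :: 'a fps fps) $ n = (\<Sum>i\<in>{1}. (fps_X :: 'a fps fps) $ i $ (n - i))"
      unfolding merge_vars_nth by (rule sum.mono_neutral_right) (auto simp: Suc)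
    then show ?thesis by (simp add: Suc)
  qed (simp add: merge_vars_nth)
qed

lemma merge_vars_prod: "merge_vars (\<Prod>i\<in>I. A i) = (\<Prod>i\<in>I. merge_vars (A i))"
  by (induction I rule: infinite_finite_induct) (simp_all add: merge_vars_1 merge_vars_mult)

lemma mult_merge_vars_nth: "(h * merge_vars A) $ n = (\<Sum>m\<le>n. (h * A $ m) $ (n - m))"
proof -
  have "h * merge_vars A = merge_vars (fps_const h * A)"
    by (simp add: merge_vars_mult merge_vars_const)
  then show ?thesis by (simp add: merge_vars_nth)
qed

definition neg_binomial :: "nat \<Rightarrow> real fps" where
  "neg_binomial M = Abs_fps (\<lambda>n. (real M + real n - 1) gchoose n)"

lemma neg_binomial: "(1 - fps_X) ^ M * neg_binomial M = 1"
proof (induction M)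
  case 0
  have "(real n - 1) gchoose n = (if n = 0 then 1 else 0)" for n
  proof (cases n)
    case (Suc m)
    then have "(real n - 1) gchoose n = real (m choose n)"
      by (simp add: binomial_gbinomial)
    then show ?thesis by (simp add: Suc)
  qed simp
  then have "neg_binomial 0 = 1"
    by (intro fps_ext) (simp add: neg_binomial_def)
  then show ?case by simp
next
  case (Suc M)
  have "(1 - fps_X) * neg_binomial (Suc M) = neg_binomial M"
  proof (rule fps_ext)
    fix n
    show "((1 - fps_X) * neg_binomial (Suc M)) $ n = neg_binomial M $ n"
    proof (cases n)
      case (Suc n')
      then show ?thesis
        using gbinomial_Suc_Suc[of "real M + real n'" n']
        by (simp add: neg_binomial_def left_diff_distrib add_ac)
    qed (simp add: neg_binomial_def)
  qed
  then have "(1 - fps_X) ^ Suc M * neg_binomial (Suc M) = (1 - fps_X) ^ M * neg_binomial M"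
    by (simp only: power_Suc2 mult.assoc)
  then show ?case using Suc by simp
qed

text \<open>The expansion of \<open>(1 - e)\<^sup>-\<^sup>M\<close> in powers of \<open>e\<close>.\<close>

lemma neg_binomial_compose:
  assumes "e $ 0 = 0" "(1 - e) * w = 1"
  shows "w ^ M = neg_binomial M oo e"
proof -
  have "((1 - fps_X) ^ M * neg_binomial M) oo e = 1"
    by (simp add: neg_binomial)
  then have *: "(1 - e) ^ M * (neg_binomial M oo e) = 1"
    using assms(1) by (simp add: fps_compose_mult_distrib fps_compose_sub_distrib flip: fps_compose_power)
  have "w ^ M = w ^ M * ((1 - e) ^ M * (neg_binomial M oo e))"
    by (simp add: *)
  also have "\<dots> = ((1 - e) * w) ^ M * (neg_binomial M oo e)"
    by (simp only: power_mult_distrib mult_ac)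
  finally show ?thesis using assms(2) by simp
qed

text \<open>Since \<open>e\<^sup>i\<close> starts in degree \<open>i\<close>, the coefficients of \<open>f(e)\<close> up to degree \<open>n\<close> only involve the
first terms of \<open>f\<close>, and the same truncation works for all of them.\<close>

lemma mult_compose_nth:
  fixes f e h :: "'a::comm_ring_1 fps"
  assumes "e $ 0 = 0"
  shows "(h * (f oo e)) $ n = (\<Sum>i\<le>n. f $ i * (h * e ^ i) $ n)"
proof -
  have "(f oo e) $ l = (\<Sum>i\<le>n. f $ i * e ^ i $ l)" if "l \<le> n" for l
    unfolding fps_compose_nth atLeast0AtMost using startsby_zero_power_prefix[OF assms] that
    by (intro sum.mono_neutral_left) auto
  then have "(h * (f oo e)) $ n = (\<Sum>j\<le>n. h $ j * (\<Sum>i\<le>n. f $ i * e ^ i $ (n - j)))"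
    by (simp add: fps_mult_nth atLeast0AtMost)
  also have "\<dots> = (\<Sum>i\<le>n. \<Sum>j\<le>n. f $ i * (h $ j * e ^ i $ (n - j)))"
    unfolding sum_distrib_left by (subst sum.swap) (simp only: mult.left_commute)
  finally show ?thesis
    by (simp add: fps_mult_nth atLeast0AtMost sum_distrib_left)
qed

context
  fixes b :: real
begin

text \<open>The substituted values: \<open>vser\<close> and \<open>eser\<close> are the series \<open>v\<close> and \<open>e\<close> of the introduction, \<open>wser\<close> is
\<open>1 / (1 - e)\<close>, and \<open>xser\<close> is \<open>e / (1 - e)\<close>.\<close>

definition "vser = Abs_fps (\<lambda>n. (1 + b) ^ n)"
definition "eser = - (fps_const b * fps_X ^ 2 * vser)"
definition "wser = one_over (1 - eser)"
definition "xser = eser * wser"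

lemma vser: "(1 - fps_const (1 + b) * fps_X) * vser = 1"
proof (rule fps_ext)
  fix n
  show "((1 - fps_const (1 + b) * fps_X) * vser) $ n = 1 $ n"
    by (cases n) (simp_all add: vser_def left_diff_distrib mult.assoc)
qed

lemma eser_nth_0: "eser $ 0 = 0"
  by (simp add: eser_def fps_mult_nth)

lemma wser: "(1 - eser) * wser = 1"
  unfolding wser_def by (rule one_over) (simp add: eser_nth_0)

lemma vser_power_nth: "vser ^ M $ p = (1 + b) ^ p * ((real M + real p - 1) gchoose p)"
proof -
  have "vser ^ M = neg_binomial M oo (fps_const (1 + b) * fps_X)"
    by (rule neg_binomial_compose) (simp_all add: vser)
  then show ?thesis by (simp add: neg_binomial_def)
qed

lemma eser_power_vser_power_nth:
  "(eser ^ n * vser ^ q) $ j = (if 2 * n \<le> j then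
     (- b) ^ n * (1 + b) ^ (j - 2 * n) * ((real n + real (j - 2 * n) + real q - 1) gchoose (j - 2 * n)) else 0)"
proof -
  have eq: "eser ^ n * vser ^ q = fps_const ((- b) ^ n) * (fps_X ^ (2 * n) * vser ^ (n + q))"
  proof -
    have "eser = fps_const (- b) * fps_X ^ 2 * vser"
      by (simp add: eser_def flip: fps_const_neg)
    then have "eser ^ n * vser ^ q = fps_const ((- b) ^ n) * ((fps_X ^ 2) ^ n * vser ^ (n + q))"
      by (simp only: power_mult_distrib power_add fps_const_power mult_ac)
    then show ?thesis by (simp only: power_mult)
  qed
  show ?thesis
    unfolding eq by (auto simp: fps_X_power_mult_nth vser_power_nth add_ac simp del: of_nat_diff)
qed

text \<open>In \<open>w\<^sup>N v\<^sup>q x\<^sup>k = e\<^sup>k (1 - e)\<^sup>-\<^sup>(\<^sup>N\<^sup>+\<^sup>k\<^sup>) v\<^sup>q\<close> the power \<open>e\<^sup>n\<close> occurs with coefficient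
\<open>(N + n - 1 over n - k)\<close>, and \<open>e\<^sup>n v\<^sup>q = (- b)\<^sup>n T\<^sup>2\<^sup>n v\<^sup>n\<^sup>+\<^sup>q\<close> is again a negative binomial series.\<close>

lemma weighted_power_nth:
  "(wser ^ N * (vser ^ q * xser ^ k)) $ j =
    (\<Sum>n | 2 * n \<le> j. binom (real N + real n - 1) (int n - int k) *
     ((- b) ^ n * (1 + b) ^ (j - 2 * n) * ((real n + real (j - 2 * n) + real q - 1) gchoose (j - 2 * n))))"
proof -
  define E where "E n = (eser ^ n * vser ^ q) $ j" for n
  define B where "B n = binom (real N + real n - 1) (int n - int k)" for n
  have "wser ^ N * (vser ^ q * xser ^ k) = (eser ^ k * vser ^ q) * wser ^ (N + k)"
    by (simp only: xser_def power_mult_distrib power_add mult_ac)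
  also have "\<dots> = (eser ^ k * vser ^ q) * (neg_binomial (N + k) oo eser)"
    using neg_binomial_compose[OF eser_nth_0 wser] by simp
  also have "\<dots> $ j = (\<Sum>i\<le>j. neg_binomial (N + k) $ i * (eser ^ k * vser ^ q * eser ^ i) $ j)"
    by (rule mult_compose_nth[OF eser_nth_0])
  also have "\<dots> = (\<Sum>i\<le>j. B (k + i) * E (k + i))"
  proof (rule sum.cong[OF refl])
    fix i
    have eq: "eser ^ k * vser ^ q * eser ^ i = eser ^ (k + i) * vser ^ q"
      by (simp only: power_add mult_ac)
    show "neg_binomial (N + k) $ i * (eser ^ k * vser ^ q * eser ^ i) $ j = B (k + i) * E (k + i)"
      unfolding eq by (simp add: E_def B_def neg_binomial_def binom_def add_ac)
  qed
  also have "\<dots> = (\<Sum>n\<in>{k..k + j}. B n * E n)"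
    by (rule sum.reindex_bij_witness[of _ "\<lambda>n. n - k" "\<lambda>i. k + i"]) auto
  also have "\<dots> = (\<Sum>n | 2 * n \<le> j. B n * E n)"
  proof (rule sum.mono_neutral_cong)
    show "finite {n. 2 * n \<le> j}" by (rule finite_subset[of _ "{..j}"]) auto
  qed (auto simp: B_def E_def binom_def eser_power_vser_power_nth)
  also have "\<dots> = (\<Sum>n | 2 * n \<le> j. B n *
     ((- b) ^ n * (1 + b) ^ (j - 2 * n) * ((real n + real (j - 2 * n) + real q - 1) gchoose (j - 2 * n))))"
    by (rule sum.cong) (auto simp: E_def eser_power_vser_power_nth)
  finally show ?thesis by (simp add: B_def)
qed

definition gen_cell :: "real \<Rightarrow> real fps" where
  "gen_cell c = wser * merge_vars (cell_series xser vser c)"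

text \<open>Let \<open>L = (1 - c T) (1 - c T v)\<close> and \<open>h = 1 / L\<close>. From \<open>(1 - e) (1 - x (h - 1)) = 1 - e h\<close> one gets the
value \<open>L / (L - e)\<close> for the cell factor. Multiplying numerator and denominator by \<open>P = 1 / v\<close> clears \<open>v\<close>
and turns \<open>e\<close> into \<open>- b T\<^sup>2\<close>, and then the denominator factors.\<close>

lemma gen_cell:
  "gen_cell c * ((1 - fps_const (c + 1) * fps_X) * (1 - fps_const (c + b) * fps_X)) =
     (1 - fps_const c * fps_X) * (1 - fps_const (c + 1 + b) * fps_X)"
proof -
  define C where "C = merge_vars (cell_series xser vser c)"
  define g where "g = geo2 (fps_const c) (fps_const c * vser)"
  define h where "h = merge_vars g"
  define u where "u = fps_const c * fps_X"
  define P where "P = 1 - fps_const (1 + b) * fps_X"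
  define L where "L = (1 - u) * (1 - u * vser)"
  have "(1 - fps_const xser * (g - 1)) * cell_series xser vser c = 1"
    unfolding cell_series_def g_def by (rule one_over) (simp add: geo2_nth_0)
  then have "merge_vars ((1 - fps_const xser * (g - 1)) * cell_series xser vser c) = 1"
    by (simp add: merge_vars_1)
  then have 1: "(1 - xser * (h - 1)) * C = 1"
    by (simp add: merge_vars_mult merge_vars_diff merge_vars_1 merge_vars_const h_def C_def)
  have "(1 - fps_const (fps_const c) * fps_X) * (1 - fps_const (fps_const c * vser) * fps_X) * g = 1"
    unfolding g_def geo2_def by (rule bi_fps_wcount_0)
  then have "merge_vars ((1 - fps_const (fps_const c) * fps_X) * (1 - fps_const (fps_const c * vser) * fps_X) * g) = 1"
    by (simp only: merge_vars_1)
  then have 2: "L * h = 1"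
    by (simp only: merge_vars_mult merge_vars_diff merge_vars_1 merge_vars_const merge_vars_X h_def L_def u_def mult_ac)
  have 3: "(1 - eser) * xser = eser"
    using wser by (simp add: xser_def mult.left_commute)
  have "(1 - eser) * (1 - xser * (h - 1)) = 1 - eser - ((1 - eser) * xser) * (h - 1)"
    by (simp add: algebra_simps)
  also have "\<dots> = 1 - eser * h" unfolding 3 by (simp add: algebra_simps)
  finally have 4: "(1 - eser) * (1 - xser * (h - 1)) = 1 - eser * h" .
  have "wser * C * (1 - eser * h) = ((1 - eser) * wser) * ((1 - xser * (h - 1)) * C)"
    unfolding 4[symmetric] by (simp only: mult_ac)
  then have 5: "wser * C * (1 - eser * h) = 1"
    by (simp only: 1 wser mult_1)
  have "wser * C * (L - eser * (L * h)) = (wser * C * (1 - eser * h)) * L"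
    by (simp add: algebra_simps)
  then have 6: "wser * C * (L - eser) = L" unfolding 2 5 by simp
  have Pv: "P * vser = 1" unfolding P_def by (rule vser)
  have "P * L = (1 - u) * (P - u * (P * vser))"
    by (simp add: L_def algebra_simps)
  then have PL: "P * L = (1 - u) * (P - u)" unfolding Pv by simp
  have "P * eser = - (fps_const b * fps_X ^ 2 * (P * vser))"
    by (simp add: eser_def mult_ac)
  then have Pe: "P * eser = - (fps_const b * fps_X ^ 2)" unfolding Pv by simp
  have "wser * C * (P * L - P * eser) = P * (wser * C * (L - eser))"
    by (simp add: algebra_simps)
  also have "\<dots> = (1 - u) * (P - u)" unfolding 6 PL ..
  finally have "wser * C * (P * L - P * eser) = (1 - u) * (P - u)" .
  moreover have "P - u = 1 - fps_const (c + 1 + b) * fps_X"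
    by (simp add: P_def u_def algebra_simps flip: fps_const_add)
  moreover have "(1 - u) * (P - u) + fps_const b * fps_X ^ 2 =
      (1 - fps_const (c + 1) * fps_X) * (1 - fps_const (c + b) * fps_X)"
    by (simp add: P_def u_def algebra_simps power2_eq_square flip: fps_const_add)
  ultimately show ?thesis
    unfolding PL Pe by (simp add: gen_cell_def C_def u_def)
qed

end

lemma card_diagram: "card (diagram lam) = weight lam"
proof -
  have "diagram lam = (SIGMA i:{1..length lam}. {1..part lam i})"
    by (auto simp: diagram_def)
  then have "card (diagram lam) = (\<Sum>i=1..length lam. part lam i)" by simp
  also have "\<dots> = (\<Sum>i<length lam. lam ! i)"
    by (simp only: One_nat_def sum.atLeast1_atMost_eq Defs.part_def) simp
  finally show ?thesis by (simp add: sum_list_sum_nth atLeast0LessThan)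
qed

text \<open>The factor \<open>1 / (1 - e)\<close> in each of the \<open>|\<lambda>|\<close> cells is the reason for the occurrence of \<open>|\<lambda>|\<close> in
the definition of \<open>c\<^sub>r\<close>.\<close>

lemma cfun_eq_coeff:
  fixes \<alpha> :: real
  defines "b \<equiv> 1 / \<alpha>"
  shows "cfun \<alpha> r lam = (\<Prod>(i, j)\<in>diagram lam. gen_cell b (content \<alpha> i j)) $ r"
proof -
  define N where "N = weight lam"
  define Q where "Q = (\<Prod>(i, j)\<in>diagram lam. cell_series (xser b) (vser b) (content \<alpha> i j))"
  define t where "t m q n = (\<Sum>k\<le>m. Ffun \<alpha> m q k lam * (binom (real N + real n - 1) (int n - int k) *
     ((- b) ^ n * (1 + b) ^ (r - m - 2 * n) * ((real n + real (r - m - 2 * n) + real q - 1) gchoose (r - m - 2 * n)))))"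
    for m q n
  have fin: "finite {n. 2 * n \<le> (j::nat)}" for j by (rule finite_subset[of _ "{..j}"]) auto
  have "(\<Prod>(i, j)\<in>diagram lam. gen_cell b (content \<alpha> i j)) = wser b ^ N * merge_vars Q"
    by (simp add: gen_cell_def case_prod_beta prod.distrib card_diagram N_def Q_def merge_vars_prod)
  also have "\<dots> $ r = (\<Sum>m\<le>r. (wser b ^ N * Q $ m) $ (r - m))"
    by (rule mult_merge_vars_nth)
  also have "\<dots> = (\<Sum>m\<le>r. \<Sum>q\<le>m. \<Sum>k\<le>m. Ffun \<alpha> m q k lam * (wser b ^ N * (vser b ^ q * xser b ^ k)) $ (r - m))"
    unfolding Q_def prod_cell_series_nth
    by (simp add: sum_distrib_left fps_sum_nth mult.left_commute[of "wser b ^ N" "fps_const c" for c])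
  also have "\<dots> = (\<Sum>m\<le>r. \<Sum>q\<le>m. \<Sum>n | 2 * n \<le> r - m. t m q n)"
    unfolding weighted_power_nth sum_distrib_left t_def by (intro sum.cong refl sum.swap)
  also have "\<dots> = (\<Sum>(m, q, n)\<in>(SIGMA m:{..r}. {..m} \<times> {n. 2 * n \<le> r - m}). t m q n)"
    using fin by (simp add: sum.Sigma sum.cartesian_product case_prod_beta)
  also have "\<dots> = (\<Sum>(n, p, q)\<in>{(n, p, q). 2 * n + p + q \<le> r}. t (r - 2 * n - p) q n)"
    by (rule sum.reindex_bij_witness[of _ "\<lambda>(n, p, q). (r - 2 * n - p, q, n)" "\<lambda>(m, q, n). (n, r - m - 2 * n, q)"]) auto
  \<comment> \<open>For \<open>k > n\<close> the binomial coefficient vanishes, hence the bound \<open>min n m\<close>.\<close>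
  also have "\<dots> = cfun \<alpha> r lam"
    unfolding cfun_def
  proof (intro sum.cong refl, clarify)
    fix n p q assume le: "2 * n + p + q \<le> r"
    define m where "m = r - 2 * n - p"
    have p: "r - m - 2 * n = p" using le by (auto simp: m_def)
    have "t m q n = (\<Sum>k=0..min n m. Ffun \<alpha> m q k lam * (binom (real N + real n - 1) (int n - int k) *
       ((- b) ^ n * (1 + b) ^ p * ((real n + real p + real q - 1) gchoose p))))"
      unfolding t_def p by (rule sum.mono_neutral_right) (auto simp: binom_def)
    also have "\<dots> = (- 1 / \<alpha>) ^ n * (1 + 1 / \<alpha>) ^ p * binom (real n + real p + real q - 1) (int p) *
       (\<Sum>k=0..min n m. binom (real (weight lam) + real n - 1) (int n - int k) * Ffun \<alpha> m q k lam)"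
      unfolding sum_distrib_left by (rule sum.cong[OF refl]) (simp add: N_def b_def binom_def mult_ac)
    finally show "t (r - 2 * n - p) q n = (- 1 / \<alpha>) ^ n * (1 + 1 / \<alpha>) ^ p * binom (real n + real p + real q - 1) (int p) *
       (\<Sum>k=0..min n (r - 2 * n - p). binom (real (weight lam) + real n - 1) (int n - int k) * Ffun \<alpha> (r - 2 * n - p) q k lam)"
      unfolding m_def .
  qed
  finally show ?thesis ..
qed

section \<open>Telescoping and partial fractions\<close>

definition lin :: "real \<Rightarrow> real fps" where
  "lin a = 1 - fps_const a * fps_X"

definition geo :: "real \<Rightarrow> real fps" where
  "geo a = Abs_fps (\<lambda>n. a ^ n)"

lemma lin_nonzero: "lin a \<noteq> 0"
proof
  assume "lin a = 0"
  then have "lin a $ 0 = 0 $ 0" by (rule arg_cong)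
  then show False by (simp add: lin_def)
qed

lemma lin_geo: "lin a * geo a = 1"
proof (rule fps_ext)
  fix n
  show "(lin a * geo a) $ n = 1 $ n"
    by (cases n) (simp_all add: lin_def geo_def left_diff_distrib mult.assoc)
qed

lemma lin_add: "lin (a + d) = lin a - fps_const d * fps_X"
  by (simp add: lin_def algebra_simps flip: fps_const_add)

text \<open>A row with first content \<open>s\<close> and \<open>m\<close> cells. For each of the two pairs of factors, a factor of one
cell cancels against one of the next, and only the two ends survive.\<close>

lemma row_product:
  assumes "\<And>c. g c * (lin (c + 1) * lin (c + b)) = lin c * lin (c + 1 + b)"
  shows "(\<Prod>j=1..m. g (real j - 1 + s)) * (lin (real m + s) * lin (s + b)) = lin s * lin (real m + s + b)"
proof (induction m)
  case (Suc m)
  define a where "a = real m + s"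
  define R where "R = (\<Prod>j=1..m. g (real j - 1 + s))"
  have IH: "R * (lin a * lin (s + b)) = lin s * lin (a + b)"
    using Suc by (simp add: R_def a_def)
  have "(R * g a * (lin (a + 1) * lin (s + b))) * (lin a * lin (a + b))
     = (R * (lin a * lin (s + b))) * (g a * (lin (a + 1) * lin (a + b)))"
    by (simp only: mult_ac)
  also have "\<dots> = (lin s * lin (a + 1 + b)) * (lin a * lin (a + b))"
    unfolding IH assms by (simp only: mult_ac)
  finally have "R * g a * (lin (a + 1) * lin (s + b)) = lin s * lin (a + 1 + b)"
    by (simp add: lin_nonzero)
  then show ?case by (simp add: R_def a_def add_ac)
qed (simp add: mult_ac)

text \<open>Row \<open>i\<close> starts with content \<open>s\<^sub>i = - (i - 1) b\<close>, and \<open>s\<^sub>i\<^sub>+\<^sub>1 + b = s\<^sub>i\<close>, so the factors belonging to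
the left ends telescope over the rows; the extra factor \<open>lin b\<close> stands for the missing row 0.\<close>

lemma diagram_product:
  fixes lam :: "nat list" and b :: real
  assumes "\<And>c. g c * (lin (c + 1) * lin (c + b)) = lin c * lin (c + 1 + b)"
  defines "a \<equiv> \<lambda>i. real (part lam i) - (real i - 1) * b"
  assumes b: "b = 1 / \<alpha>"
  shows "lin b * (\<Prod>(i, j)\<in>diagram lam. g (content \<alpha> i j)) * (\<Prod>i=1..length lam. lin (a i))
     = lin (- ((real (length lam) - 1) * b)) * (\<Prod>i=1..length lam. lin (a i + b))"
proof -
  define s where "s i = - ((real i - 1) * b)" for i :: nat
  let ?I = "{1..length lam}"
  have a_s: "a i = real (part lam i) + s i" for i
    by (simp add: a_def s_def)
  have tel: "lin b * (\<Prod>i=1..l. lin (s i)) = lin (s l) * (\<Prod>i=1..l. lin (s i + b))" for l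
  proof (induction l)
    case (Suc l)
    have "s (Suc l) + b = s l" by (simp add: s_def algebra_simps)
    with Suc show ?case by (simp add: mult_ac)
  qed (simp add: s_def)
  have "diagram lam = (SIGMA i:?I. {1..part lam i})"
    by (auto simp: diagram_def)
  then have "(\<Prod>(i, j)\<in>diagram lam. g (content \<alpha> i j)) = (\<Prod>i\<in>?I. \<Prod>j=1..part lam i. g (real j - 1 + s i))"
    by (simp add: prod.Sigma content_def s_def b)
  moreover have "(\<Prod>i\<in>?I. (\<Prod>j=1..part lam i. g (real j - 1 + s i)) * (lin (a i) * lin (s i + b)))
      = (\<Prod>i\<in>?I. lin (s i) * lin (a i + b))"
    by (intro prod.cong refl) (simp only: a_s row_product[of g b, OF assms(1)])
  ultimately have *: "(\<Prod>(i, j)\<in>diagram lam. g (content \<alpha> i j)) * ((\<Prod>i\<in>?I. lin (a i)) * (\<Prod>i\<in>?I. lin (s i + b)))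
    = (\<Prod>i\<in>?I. lin (s i)) * (\<Prod>i\<in>?I. lin (a i + b))"
    by (simp add: prod.distrib)
  let ?G = "\<Prod>(i, j)\<in>diagram lam. g (content \<alpha> i j)"
  have "(lin b * ?G * (\<Prod>i\<in>?I. lin (a i))) * (\<Prod>i\<in>?I. lin (s i + b))
     = (lin b * (\<Prod>i\<in>?I. lin (s i))) * (\<Prod>i\<in>?I. lin (a i + b))"
    using * by (simp only: mult.assoc)
  also have "\<dots> = (lin (s (length lam)) * (\<Prod>i\<in>?I. lin (a i + b))) * (\<Prod>i\<in>?I. lin (s i + b))"
    unfolding tel by (simp only: mult_ac)
  finally show ?thesis
    by (simp add: lin_nonzero s_def)
qed

text \<open>A partial fraction decomposition based only on the resolvent identity. Both \<open>\<phi>\<^sub>i = 1 / (z - a\<^sub>i)\<close> for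
a number \<open>z\<close> and \<open>\<phi>\<^sub>i = T / (1 - a\<^sub>i T)\<close> satisfy it. The second is the case of interest, but adding
a new index \<open>n\<close> requires the first at \<open>z = a\<^sub>n\<close>, which evaluates the coefficient of \<open>\<phi>\<^sub>n\<close>; this is why
\<open>\<phi>\<close> is arbitrary in the induction.\<close>

lemma resolvent_product:
  fixes \<phi> :: "'i \<Rightarrow> real fps" and a :: "'i \<Rightarrow> real"
  assumes "finite I" "inj_on a I"
    and "\<And>i j. i \<in> I \<Longrightarrow> j \<in> I \<Longrightarrow> fps_const (a i - a j) * (\<phi> i * \<phi> j) = \<phi> i - \<phi> j"
  shows "(\<Prod>i\<in>I. 1 - fps_const b * \<phi> i) =
    1 - fps_const b * (\<Sum>i\<in>I. fps_const (\<Prod>j\<in>I - {i}. (a i - a j - b) / (a i - a j)) * \<phi> i)"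
  using assms
proof (induction I arbitrary: \<phi> rule: finite_induct)
  case (insert n I)
  define w where "w i = (\<Prod>j\<in>I - {i}. (a i - a j - b) / (a i - a j))" for i
  define d where "d i = a n - a i" for i
  have inj: "inj_on a I" using insert.prems(1) by simp
  have d: "d i \<noteq> 0" if "i \<in> I" for i
    using insert.prems(1) insert.hyps(2) that by (auto simp: d_def inj_on_def)
  have IH: "(\<Prod>i\<in>I. 1 - fps_const b * \<phi> i) = 1 - fps_const b * (\<Sum>i\<in>I. fps_const (w i) * \<phi> i)"
    unfolding w_def using insert by (intro insert.IH) auto
  have "fps_const (a i - a j) * (fps_const (1 / d i) * fps_const (1 / d j))
      = fps_const (1 / d i) - fps_const (1 / d j)" if "i \<in> I" "j \<in> I" for i j
    using d[OF that(1)] d[OF that(2)] by (simp add: field_simps d_def)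
  \<comment> \<open>The induction hypothesis at \<open>\<phi>\<^sub>i = 1 / (a\<^sub>n - a\<^sub>i)\<close>.\<close>
  from insert.IH[OF inj this]
  have wn0: "(\<Prod>i\<in>I. 1 - fps_const b * fps_const (1 / d i)) = 1 - fps_const b * (\<Sum>i\<in>I. fps_const (w i) * fps_const (1 / d i))"
    unfolding w_def by simp
  define wn where "wn = (\<Prod>j\<in>I. (a n - a j - b) / (a n - a j))"
  have "fps_const wn = (\<Prod>i\<in>I. 1 - fps_const b * fps_const (1 / d i))"
  proof -
    have c: "fps_const (\<Prod>i\<in>A. f i) = (\<Prod>i\<in>A. fps_const (f i))" for f :: "'i \<Rightarrow> real" and A
      by (induction A rule: infinite_finite_induct) (simp_all flip: fps_const_mult)
    have "fps_const ((a n - a i - b) / (a n - a i)) = 1 - fps_const b * fps_const (1 / d i)" if "i \<in> I" for i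
      using d[OF that] by (simp add: d_def diff_divide_distrib flip: fps_const_sub)
    then show ?thesis unfolding wn_def c by (rule prod.cong[OF refl])
  qed
  then have wn: "fps_const wn = 1 - fps_const b * (\<Sum>i\<in>I. fps_const (w i) * fps_const (1 / d i))"
    using wn0 by simp
  have res: "\<phi> n * \<phi> i = fps_const (1 / d i) * (\<phi> n - \<phi> i)" if "i \<in> I" for i
  proof -
    have "\<phi> n - \<phi> i = fps_const (d i) * (\<phi> n * \<phi> i)"
      using insert.prems(2)[of n i] that by (simp add: d_def)
    then have "fps_const (1 / d i) * (\<phi> n - \<phi> i) = fps_const (1 / d i * d i) * (\<phi> n * \<phi> i)"
      by (simp only: mult.assoc flip: fps_const_mult)
    then show ?thesis using d[OF that] by simp
  qed
  have w_insert: "(\<Prod>j\<in>insert n I - {i}. (a i - a j - b) / (a i - a j)) = w i * (1 + b / d i)" if "i \<in> I" for i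
  proof -
    have "insert n I - {i} = insert n (I - {i})" using insert.hyps(2) that by auto
    moreover have "(a i - a n - b) / (a i - a n) = 1 + b / d i"
      using d[OF that] by (simp add: d_def field_simps)
    ultimately show ?thesis using insert.hyps by (simp add: w_def mult.commute)
  qed
  let ?W = "\<Sum>i\<in>I. fps_const (w i) * \<phi> i"
  let ?V = "\<Sum>i\<in>I. fps_const (w i) * fps_const (1 / d i)"
  let ?U = "\<Sum>i\<in>I. fps_const (w i) * (fps_const (1 / d i) * \<phi> i)"
  have W: "\<phi> n * ?W = ?V * \<phi> n - ?U"
    unfolding sum_distrib_left sum_distrib_right sum_subtractf[symmetric]
    by (intro sum.cong refl) (simp add: mult.left_commute[of "\<phi> n"] res right_diff_distrib mult.assoc del: fps_const_mult)
  have "(\<Prod>j\<in>insert n I - {n}. (a n - a j - b) / (a n - a j)) = wn"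
    using insert.hyps(2) by (simp add: wn_def)
  then have "(\<Sum>i\<in>insert n I. fps_const (\<Prod>j\<in>insert n I - {i}. (a i - a j - b) / (a i - a j)) * \<phi> i)
     = fps_const wn * \<phi> n + (\<Sum>i\<in>I. fps_const (w i * (1 + b / d i)) * \<phi> i)"
    using insert.hyps w_insert by simp
  also have "(\<Sum>i\<in>I. fps_const (w i * (1 + b / d i)) * \<phi> i) = ?W + fps_const b * ?U"
    unfolding sum_distrib_left sum.distrib[symmetric]
  proof (intro sum.cong refl)
    fix i
    have "fps_const (w i * (1 + b / d i)) = fps_const (w i) + fps_const b * (fps_const (w i) * fps_const (1 / d i))"
      by (simp add: algebra_simps)
    then show "fps_const (w i * (1 + b / d i)) * \<phi> i = fps_const (w i) * \<phi> i + fps_const b * (fps_const (w i) * (fps_const (1 / d i) * \<phi> i))"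
      by (simp only: distrib_right mult.assoc)
  qed
  finally have R: "(\<Sum>i\<in>insert n I. fps_const (\<Prod>j\<in>insert n I - {i}. (a i - a j - b) / (a i - a j)) * \<phi> i)
     = (1 - fps_const b * ?V) * \<phi> n + (?W + fps_const b * ?U)"
    unfolding wn .
  have "(\<Prod>i\<in>insert n I. 1 - fps_const b * \<phi> i) = (1 - fps_const b * \<phi> n) * (1 - fps_const b * ?W)"
    using insert.hyps IH by simp
  also have "\<dots> = 1 - fps_const b * \<phi> n - fps_const b * ?W + fps_const b * (fps_const b * (\<phi> n * ?W))"
    by (simp add: algebra_simps del: fps_const_mult)
  also have "\<dots> = 1 - fps_const b * ((1 - fps_const b * ?V) * \<phi> n + (?W + fps_const b * ?U))"
    unfolding W by (simp add: algebra_simps del: fps_const_mult)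
  finally show ?case unfolding R .
qed simp

section \<open>The expansion of sigma\<close>

theorem theorem9p1:
  fixes \<alpha> :: real and lam :: "nat list" and r :: nat
  assumes "\<alpha> > 0" and "is_partition lam"
  shows "sigma \<alpha> r lam = cfun \<alpha> (r + 1) lam - \<alpha> * cfun \<alpha> (r + 2) lam"
proof -
  define b where "b = 1 / \<alpha>"
  have b: "b > 0" "\<alpha> * b = 1" using assms(1) by (simp_all add: b_def)
  define a where "a i = real (part lam i) - (real i - 1) * b" for i
  define s where "s = - ((real (length lam) - 1) * b)"
  define I where "I = {1..length lam}"
  define w where "w i = (\<Prod>j\<in>I - {i}. (a i - a j - b) / (a i - a j))" for i
  define G where "G = (\<Prod>(i, j)\<in>diagram lam. gen_cell b (content \<alpha> i j))"
  have fin: "finite I" by (simp add: I_def)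
  have mono: "a j < a i" if "i \<in> I" "j \<in> I" "i < j" for i j
  proof -
    have "part lam j \<le> part lam i"
      using assms(2) that sorted_wrt_nth_less[of "(\<ge>)" lam "i - 1" "j - 1"]
      by (auto simp: I_def is_partition_def Defs.part_def)
    moreover have "(real i - 1) * b < (real j - 1) * b"
      using that b by simp
    ultimately show ?thesis by (simp add: a_def)
  qed
  have inj: "inj_on a I"
  proof (rule inj_onI)
    fix i j assume ij: "i \<in> I" "j \<in> I" "a i = a j"
    show "i = j" using mono[OF ij(1,2)] mono[OF ij(2,1)] ij(3) by (cases i j rule: linorder_cases) auto
  qed
  have G: "lin b * G * (\<Prod>i\<in>I. lin (a i)) = lin s * (\<Prod>i\<in>I. lin (a i + b))"
    unfolding G_def a_def s_def I_def
    by (intro diagram_product gen_cell[folded lin_def] b_def)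
  have geo_res: "fps_const (x - y) * ((fps_X * geo x) * (fps_X * geo y)) = fps_X * geo x - fps_X * geo y" for x y
  proof -
    have "fps_const (x - y) * fps_X = lin y - lin x"
      by (simp add: lin_def algebra_simps flip: fps_const_sub)
    then have "fps_const (x - y) * ((fps_X * geo x) * (fps_X * geo y))
       = fps_X * ((lin y - lin x) * (geo x * geo y))"
      by (metis mult.assoc mult.left_commute)
    also have "\<dots> = fps_X * (geo x * (lin y * geo y)) - fps_X * (geo y * (lin x * geo x))"
      by (simp add: algebra_simps)
    finally show ?thesis by (simp add: lin_geo)
  qed
  have lin_geo_b: "lin (x + b) * geo x = 1 - fps_const b * (fps_X * geo x)" for x
    unfolding lin_add using lin_geo[of x] by (simp add: left_diff_distrib mult.assoc)
  have "lin b * G = lin b * G * (\<Prod>i\<in>I. lin (a i) * geo (a i))"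
    by (simp add: lin_geo)
  also have "\<dots> = (lin b * G * (\<Prod>i\<in>I. lin (a i))) * (\<Prod>i\<in>I. geo (a i))"
    by (simp only: prod.distrib mult.assoc)
  also have "\<dots> = lin s * (\<Prod>i\<in>I. lin (a i + b) * geo (a i))"
    unfolding G by (simp only: prod.distrib mult.assoc)
  also have "\<dots> = lin s * (1 - fps_const b * (\<Sum>i\<in>I. fps_const (w i) * (fps_X * geo (a i))))"
    unfolding lin_geo_b w_def by (subst resolvent_product[OF fin inj geo_res]) rule
  also have "\<dots> = lin s - fps_const b * (\<Sum>i\<in>I. fps_const (w i) * (fps_X * (lin s * geo (a i))))"
    by (simp add: right_diff_distrib sum_distrib_left mult.left_commute[of "lin s"])
  finally have main: "lin b * G = lin s - fps_const b * (\<Sum>i\<in>I. fps_const (w i) * (fps_X * (lin s * geo (a i))))" .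
  \<comment> \<open>The factor \<open>1 - s T\<close> completes the residue \<open>w\<^sub>i\<close> to the Jack binomial coefficient.\<close>
  have coeff: "(lin s * geo x) $ Suc r = (x - s) * x ^ r" for x
    by (simp add: lin_def geo_def left_diff_distrib mult.assoc)
  have jack: "w i * (a i - s) = jack_binom \<alpha> lam i" if "i \<in> I" for i
  proof -
    have "(a i - a j - b) / (a i - a j) = (\<alpha> * (real (part lam i) - real (part lam j)) + real j - real i - 1) /
        (\<alpha> * (real (part lam i) - real (part lam j)) + real j - real i)" for j
    proof -
      have "\<alpha> * (a i - a j) = \<alpha> * (real (part lam i) - real (part lam j)) + (real j - real i) * (\<alpha> * b)"
        by (simp add: a_def algebra_simps)
      then have 1: "\<alpha> * (a i - a j) = \<alpha> * (real (part lam i) - real (part lam j)) + real j - real i"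
        using b by simp
      have "(a i - a j - b) / (a i - a j) = (\<alpha> * (a i - a j - b)) / (\<alpha> * (a i - a j))"
        using assms(1) by simp
      also have "\<alpha> * (a i - a j - b) = \<alpha> * (a i - a j) - 1"
        using b by (simp add: right_diff_distrib)
      finally show ?thesis unfolding 1 .
    qed
    moreover have "a i - s = real (part lam i) + (real (length lam) - real i) / \<alpha>"
      by (simp add: a_def s_def b_def algebra_simps diff_divide_distrib)
    ultimately show ?thesis
      by (simp add: jack_binom_def w_def I_def)
  qed
  have "G $ (r + 2) - b * G $ (r + 1) = (lin b * G) $ (r + 2)"
    by (simp add: lin_def left_diff_distrib mult.assoc)
  also have "\<dots> = - b * (\<Sum>i\<in>I. w i * ((a i - s) * a i ^ r))"
    unfolding main by (simp add: lin_def[of s] fps_sum_nth coeff[unfolded lin_def])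
  also have "\<dots> = - b * sigma \<alpha> r lam"
    using jack by (simp add: sigma_def I_def a_def b_def mult_ac mult.assoc[symmetric])
  finally have "\<alpha> * G $ (r + 2) - (\<alpha> * b) * G $ (r + 1) = - (\<alpha> * b) * sigma \<alpha> r lam"
    by (metis (no_types) minus_mult_left mult.assoc mult_minus_right right_diff_distrib)
  then show ?thesis
    using b by (simp add: G_def cfun_eq_coeff b_def)
qed

end
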